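(* Let $G=(V,E)$ be an infinite, countable, connected, locally finite, quasi-transitive graph. Consider the partially oriented long-range bond percolation model on $V$ with positive parameters $J_{[x,y]}$ and $J_{[x,y\rangle}$ (for $x\ne y$ in $V$) that are invariant under $\mathrm{Aut}(G)$ and satisfy $$J_0:=\sup_{x\in V}\ \sum_{y\in V}\big(J_{[x,y]}+J_{[x,y\rangle}\big)<\infty .$$ Then $\beta_H=\beta_T$.
   Context: $G$ is quasi-transitive if $\mathrm{Aut}(G)$ acts on $V$ with finitely many orbits. Partially oriented long-range model: every pair of distinct vertices $x,y\in V$ is joined by one unoriented edge $[x,y]$ and by two oriented edges, $[x,y\rangle$ (from $x$ to $y$) and $[y,x\rangle$ (from $y$ to $x$). Given positive numbers $J_{[x,y]}=J_{[y,x]}$ and $J_{[x,y\rangle}$ and $\beta>0$, all edges are independently open or closed; the unoriented edge $[x,y]$ is open with probability $1-e^{-\beta J_{[x,y]}}$ and the oriented edge $[x,y\rangle$ is open with probability $1-e^{-\beta J_{[x,y\rangle}}$. Invariance means $J_{[\gamma x,\gamma y]}=J_{[x,y]}$ and $J_{[\gamma x,\gamma y\rangle}=J_{[x,y\rangle}$ for all $\gamma\in\mathrm{Aut}(G)$ and all $x,y$. The product measure is $\mathbb{P}_\beta$, with expectation $\mathbb{E}_\beta$. Open paths may use open unoriented edges in either direction, and open oriented edges only in the direction of their orientation. The cluster $C_x$ has as vertices all vertices that can be reached from $x$ by an open path (including $x$); $|C_x|$ is its number of vertices. The critical values, as elements of $[0,\infty]$, are $$\beta_H:=\sup\{\beta>0:\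 \mathbb{P}_\beta(|C_x|=\infty)=0\},\qquad \beta_T:=\sup\{\beta>0:\ \mathbb{E}_\beta(|C_x|)<\infty\}$$ (with $\sup\emptyset=0$); they do not depend on $x$. *)

theory Defs
  imports "HOL-Probability.Probability"
begin

section \<open>Graphs\<close>

definition simple_graph :: "'v set \<Rightarrow> 'v set set \<Rightarrow> bool" where
  "simple_graph V E \<longleftrightarrow> E \<subseteq> {{x, y} | x y. x \<in> V \<and> y \<in> V \<and> x \<noteq> y}"

definition connected_graph :: "'v set \<Rightarrow> 'v set set \<Rightarrow> bool" where
  "connected_graph V E \<longleftrightarrow> (\<forall>x\<in>V. \<forall>y\<in>V. (x, y) \<in> {(u, v). {u, v} \<in> E}\<^sup>*)"

definition locally_finite_graph :: "'v set \<Rightarrow> 'v set set \<Rightarrow> bool" where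
  "locally_finite_graph V E \<longleftrightarrow> (\<forall>x\<in>V. finite {y \<in> V. {x, y} \<in> E})"

text \<open>Only the restriction of an automorphism to \<open>V\<close> matters; its values elsewhere are
  arbitrary.\<close>

definition graph_aut :: "'v set \<Rightarrow> 'v set set \<Rightarrow> ('v \<Rightarrow> 'v) set" where
  "graph_aut V E = {\<gamma>. bij_betw \<gamma> V V \<and>
     (\<forall>x\<in>V. \<forall>y\<in>V. {\<gamma> x, \<gamma> y} \<in> E \<longleftrightarrow> {x, y} \<in> E)}"

definition aut_orbit :: "'v set \<Rightarrow> 'v set set \<Rightarrow> 'v \<Rightarrow> 'v set" where
  "aut_orbit V E x = {\<gamma> x | \<gamma>. \<gamma> \<in> graph_aut V E}"

definition quasi_transitive :: "'v set \<Rightarrow> 'v set set \<Rightarrow> bool" where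
  "quasi_transitive V E \<longleftrightarrow> finite (aut_orbit V E ` V)"


section \<open>Partially oriented long-range percolation\<close>

text \<open>The unoriented edge \<open>[x,y]\<close> is \<open>Unoriented {x, y}\<close>, so that \<open>[x,y] = [y,x]\<close> and the
  symmetry of the corresponding parameters is built in; \<open>Oriented x y\<close> is the edge from \<open>x\<close>
  to \<open>y\<close>.\<close>

datatype 'v bond = Unoriented "'v set" | Oriented 'v 'v

definition bonds :: "'v set \<Rightarrow> 'v bond set" where
  "bonds V = {Unoriented {x, y} | x y. x \<in> V \<and> y \<in> V \<and> x \<noteq> y}
           \<union> {Oriented x y | x y. x \<in> V \<and> y \<in> V \<and> x \<noteq> y}"

definition aut_invariant :: "'v set \<Rightarrow> 'v set set \<Rightarrow> ('v bond \<Rightarrow> real) \<Rightarrow> bool" where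
  "aut_invariant V E J \<longleftrightarrow> (\<forall>\<gamma>\<in>graph_aut V E. \<forall>x\<in>V. \<forall>y\<in>V. x \<noteq> y \<longrightarrow>
     J (Unoriented {\<gamma> x, \<gamma> y}) = J (Unoriented {x, y}) \<and>
     J (Oriented (\<gamma> x) (\<gamma> y)) = J (Oriented x y))"

definition J0 :: "'v set \<Rightarrow> ('v bond \<Rightarrow> real) \<Rightarrow> ennreal" where
  "J0 V J = (SUP x\<in>V. \<Sum>\<^sub>\<infinity>y\<in>V - {x}. ennreal (J (Unoriented {x, y}) + J (Oriented x y)))"

definition perc :: "'v set \<Rightarrow> ('v bond \<Rightarrow> real) \<Rightarrow> real \<Rightarrow> ('v bond \<Rightarrow> bool) measure" where
  "perc V J \<beta> = (\<Pi>\<^sub>M e\<in>bonds V. measure_pmf (bernoulli_pmf (1 - exp (- \<beta> * J e))))"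

definition open_step :: "'v set \<Rightarrow> ('v bond \<Rightarrow> bool) \<Rightarrow> ('v \<times> 'v) set" where
  "open_step V \<omega> = {(u, v). u \<in> V \<and> v \<in> V \<and> u \<noteq> v \<and>
     (\<omega> (Unoriented {u, v}) \<or> \<omega> (Oriented u v))}"

definition cluster :: "'v set \<Rightarrow> ('v bond \<Rightarrow> bool) \<Rightarrow> 'v \<Rightarrow> 'v set" where
  "cluster V \<omega> x = {y. (x, y) \<in> (open_step V \<omega>)\<^sup>*}"

definition cluster_size :: "'v set \<Rightarrow> ('v bond \<Rightarrow> bool) \<Rightarrow> 'v \<Rightarrow> ennreal" where
  "cluster_size V \<omega> x = emeasure (count_space UNIV) (cluster V \<omega> x)"

text \<open>In \<^typ>\<open>ennreal\<close> the supremum of the empty set is 0.\<close>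

definition beta_H :: "'v set \<Rightarrow> ('v bond \<Rightarrow> real) \<Rightarrow> 'v \<Rightarrow> ennreal" where
  "beta_H V J x =
     (SUP \<beta>\<in>{\<beta>. 0 < \<beta> \<and> \<P>(\<omega> in perc V J \<beta>. cluster_size V \<omega> x = \<infinity>) = 0}. ennreal \<beta>)"

definition beta_T :: "'v set \<Rightarrow> ('v bond \<Rightarrow> real) \<Rightarrow> 'v \<Rightarrow> ennreal" where
  "beta_T V J x =
     (SUP \<beta>\<in>{\<beta>. 0 < \<beta> \<and> (\<integral>\<^sup>+\<omega>. cluster_size V \<omega> x \<partial>perc V J \<beta>) < \<infinity>}. ennreal \<beta>)"

text \<open>For countable \<open>V\<close> the cluster size is a random variable, so the probability and the
  expectation above are not default values for non-measurable arguments.\<close>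

lemma measurable_reachable:
  assumes "countable V" "x \<in> V"
  shows "Measurable.pred (perc V J \<beta>) (\<lambda>\<omega>. (x, y) \<in> (open_step V \<omega>)\<^sup>*)"
proof -
  have step: "Measurable.pred (perc V J \<beta>) (\<lambda>\<omega>. (u, v) \<in> open_step V \<omega>)" for u v
  proof (cases "u \<in> V \<and> v \<in> V \<and> u \<noteq> v")
    case True
    have coord: "Measurable.pred (perc V J \<beta>) (\<lambda>\<omega>. \<omega> e)" if "e \<in> bonds V" for e
    proof -
      have "(\<lambda>\<omega>. \<omega> e) \<in> perc V J \<beta> \<rightarrow>\<^sub>M measure_pmf (bernoulli_pmf (1 - exp (- \<beta> * J e)))"
        unfolding perc_def by (rule measurable_component_singleton[OF that])
      then show ?thesis by simp
    qed
    have "Unoriented {u, v} \<in> bonds V" "Oriented u v \<in> bonds V"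
      using True by (auto simp: bonds_def)
    then show ?thesis using True coord by (simp add: open_step_def)
  qed (auto simp: open_step_def)
  have pow: "Measurable.pred (perc V J \<beta>) (\<lambda>\<omega>. (x, y) \<in> open_step V \<omega> ^^ n)" for n y
  proof (induction n arbitrary: y)
    case (Suc n)
    have "(\<lambda>\<omega>. (x, y) \<in> open_step V \<omega> ^^ Suc n) =
        (\<lambda>\<omega>. \<exists>z\<in>V. (x, z) \<in> open_step V \<omega> ^^ n \<and> (z, y) \<in> open_step V \<omega>)"
      by (auto simp: fun_eq_iff open_step_def relcomp_unfold)
    with Suc step assms(1) show ?case by simp
  qed simp
  then show ?thesis by (simp add: rtrancl_power)
qed

lemma cluster_subset: "x \<in> V \<Longrightarrow> cluster V \<omega> x \<subseteq> V"
  unfolding cluster_def by (auto elim: rtranclE simp: open_step_def)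

lemma measurable_cluster_size [measurable]:
  assumes "countable V" "x \<in> V"
  shows "(\<lambda>\<omega>. cluster_size V \<omega> x) \<in> borel_measurable (perc V J \<beta>)"
proof -
  note measurable_reachable[OF assms, measurable]
  have "cluster_size V \<omega> x = (\<integral>\<^sup>+y. indicator (cluster V \<omega> x) y \<partial>count_space V)" for \<omega>
    using cluster_subset[OF assms(2), of \<omega>]
    by (simp add: cluster_size_def emeasure_count_space)
  moreover have "(\<lambda>\<omega>. \<integral>\<^sup>+y. indicator (cluster V \<omega> x) y \<partial>count_space V)
      \<in> borel_measurable (perc V J \<beta>)"
  proof (rule sigma_finite_measure.borel_measurable_nn_integral)
    have "(\<lambda>(y, \<omega>). indicator (cluster V \<omega> x) y :: ennreal)
        \<in> borel_measurable (count_space V \<Otimes>\<^sub>M perc V J \<beta>)"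
      using assms(1)
      by (rule measurable_pair_measure_countable1) (simp add: cluster_def indicator_def)
    then show "(\<lambda>(\<omega>, y). indicator (cluster V \<omega> x) y :: ennreal)
        \<in> borel_measurable (perc V J \<beta> \<Otimes>\<^sub>M count_space V)"
      using measurable_pair_swap_iff by force
  qed (rule sigma_finite_measure_count_space_countable[OF assms(1)])
  ultimately show ?thesis by simp
qed

end

theory Submission
  imports Defs
begin

text \<open>
  The inequality \<open>\<beta>\<^sub>T \<le> \<beta>\<^sub>H\<close> holds because a variable with finite expectation is almost surely
  finite. The converse follows the argument of Duminil-Copin and Tassion. For a finite set
  \<open>S\<close> containing \<open>x\<close>, the \<open>flux\<close> out of \<open>S\<close> is the sum over \<open>y \<in> S\<close> of the probability that
  \<open>x\<close> reaches \<open>y\<close> inside \<open>S\<close>, weighted with the total parameter of the bonds leading from \<open>y\<close>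
  out of \<open>S\<close>; so \<open>\<beta> * flux\<close> bounds the expected number of open exits from \<open>S\<close>. There are two
  cases.

  \<^item> At \<open>\<beta>\<close>, every vertex \<open>x\<close> lies in some finite \<open>S\<close> with \<open>\<beta> * flux < 1\<close>. Because there are
    finitely many orbits, the sizes of these sets and the gaps to 1 can be chosen uniformly
    (\<open>uniform_flux_bound\<close>). A cluster is then dominated by a subcritical branching process: after
    the exploration of the part of it inside \<open>S\<close>, each open exit starts a cluster in the
    complement of the explored set, which is independent of what was seen. The expected size is
    thus finite (\<open>expected_volume_bound\<close>).

  \<^item> At \<open>\<beta>0\<close>, some \<open>x\<close> has \<open>\<beta>0 * flux \<ge> 1\<close> for every finite \<open>S\<close>. Let \<open>f \<beta>\<close> be the probability
    that \<open>x\<close> reaches the outside of a finite set \<open>L\<close>. If it does not, let \<open>S\<close> be the set of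
    vertices of \<open>L\<close> that do not reach the outside. Every bond from a vertex that \<open>x\<close>
    reaches in \<open>S\<close> to a vertex outside \<open>S\<close> is pivotal, and the state of the bonds inside \<open>S\<close> is
    independent of the event that \<open>S\<close> is this set. Hence Russo's formula bounds \<open>f'\<close> below by
    the flux times \<open>1 - f\<close> (\<open>escape_influence\<close>), and integration gives a lower bound for \<open>f \<beta>1\<close>,
    where \<open>\<beta>1 > \<beta>0\<close>, that does not depend on \<open>L\<close> (\<open>escape_prob_ge\<close>). Infinite clusters thus
    have positive probability at \<open>\<beta>1\<close> (\<open>infinite_cluster_if_flux_large\<close>).

  So if \<open>\<beta>1\<close> has no infinite clusters then every \<open>\<beta>0 < \<beta>1\<close> is in the first case, which is
  \<open>sharpness\<close>.

  Both arguments run in finite volume, where the expectations are finite sums. This also deals with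
  the infinite range: instead of the event that \<open>x\<close> leaves \<open>L\<close>, which depends on infinitely many
  bonds, one considers the event that \<open>x\<close> leaves \<open>L\<close> inside a finite set \<open>M\<close> so large that
  the bonds from \<open>L\<close> to the complement of \<open>M\<close> carry little flux (\<open>flux_truncate\<close>).
\<close>

section \<open>Finite Bernoulli expectations\<close>

text \<open>Expectation of a function of the set of open elements of the finite set \<open>B\<close>, when \<open>e\<close> is
  open with probability \<open>p e\<close> independently of the others. Configurations are sets, so that opening
  a bond is \<^const>\<open>insert\<close> and restricting a configuration is an intersection.\<close>
definition bexp :: "'b set \<Rightarrow> ('b \<Rightarrow> real) \<Rightarrow> ('b set \<Rightarrow> real) \<Rightarrow> real" where
  "bexp B p F = (\<Sum>\<omega>\<in>Pow B. (\<Prod>e\<in>\<omega>. p e) * (\<Prod>e\<in>B - \<omega>. 1 - p e) * F \<omega>)"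

lemma bexp_empty [simp]: "bexp {} p F = F {}"
  by (simp add: bexp_def)

text \<open>Conditioning on the state of one element turns the properties of the expectation
  into inductions over the finite set.\<close>
lemma bexp_insert:
  assumes "finite B" "e \<notin> B"
  shows "bexp (insert e B) p F = p e * bexp B p (\<lambda>\<omega>. F (insert e \<omega>)) + (1 - p e) * bexp B p F"
proof -
  let ?w = "\<lambda>B \<omega>. (\<Prod>e\<in>\<omega>. p e) * (\<Prod>e\<in>B - \<omega>. 1 - p e)"
  have inj: "inj_on (insert e) (Pow B)"
    using assms(2) by (auto simp: inj_on_def)
  have "bexp (insert e B) p F
      = (\<Sum>\<omega>\<in>Pow B. ?w (insert e B) \<omega> * F \<omega>) + (\<Sum>\<omega>\<in>insert e ` Pow B. ?w (insert e B) \<omega> * F \<omega>)"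
    unfolding bexp_def Pow_insert
    by (rule sum.union_disjoint) (use assms in auto)
  also have "(\<Sum>\<omega>\<in>insert e ` Pow B. ?w (insert e B) \<omega> * F \<omega>)
      = (\<Sum>\<omega>\<in>Pow B. p e * (?w B \<omega> * F (insert e \<omega>)))"
  proof (subst sum.reindex[OF inj], rule sum.cong, goal_cases)
    case (2 \<omega>)
    have "finite \<omega>" "e \<notin> \<omega>" "insert e B - insert e \<omega> = B - \<omega>"
      using 2 assms finite_subset by auto
    then show ?case by simp
  qed simp
  also have "(\<Sum>\<omega>\<in>Pow B. ?w (insert e B) \<omega> * F \<omega>) = (\<Sum>\<omega>\<in>Pow B. (1 - p e) * (?w B \<omega> * F \<omega>))"
  proof (rule sum.cong, goal_cases)
    case (2 \<omega>)
    have "insert e B - \<omega> = insert e (B - \<omega>)" "e \<notin> B - \<omega>" "finite (B - \<omega>)"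
      using 2 assms by auto
    then show ?case by simp
  qed simp
  finally show ?thesis
    by (simp add: bexp_def sum_distrib_left)
qed

lemma bexp_cong: "(\<And>\<omega>. \<omega> \<subseteq> B \<Longrightarrow> F \<omega> = G \<omega>) \<Longrightarrow> bexp B p F = bexp B p G"
  unfolding bexp_def by (rule sum.cong) auto

lemma bexp_cong_prob: "(\<And>e. e \<in> B \<Longrightarrow> p e = q e) \<Longrightarrow> bexp B p F = bexp B q F"
  unfolding bexp_def
  by (intro sum.cong refl arg_cong2[where f = times] prod.cong) auto

lemma bexp_sum: "bexp B p (\<lambda>\<omega>. \<Sum>i\<in>I. F i \<omega>) = (\<Sum>i\<in>I. bexp B p (F i))"
  unfolding bexp_def sum_distrib_left by (rule sum.swap)

lemma bexp_add: "bexp B p (\<lambda>\<omega>. F \<omega> + G \<omega>) = bexp B p F + bexp B p G"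
  unfolding bexp_def by (simp add: distrib_left sum.distrib)

lemma bexp_diff: "bexp B p (\<lambda>\<omega>. F \<omega> - G \<omega>) = bexp B p F - bexp B p G"
  unfolding bexp_def by (simp add: right_diff_distrib sum_subtractf)

lemma bexp_cmult: "bexp B p (\<lambda>\<omega>. c * F \<omega>) = c * bexp B p F"
  unfolding bexp_def by (simp add: sum_distrib_left mult_ac)

lemma bexp_const: "finite B \<Longrightarrow> bexp B p (\<lambda>_. c) = c"
  by (induction B rule: finite_induct) (simp_all add: bexp_insert algebra_simps)

lemma bexp_mono:
  assumes "\<And>e. e \<in> B \<Longrightarrow> 0 \<le> p e \<and> p e \<le> 1" "\<And>\<omega>. \<omega> \<subseteq> B \<Longrightarrow> F \<omega> \<le> G \<omega>"
  shows "bexp B p F \<le> bexp B p G"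
  unfolding bexp_def
  by (intro sum_mono mult_left_mono mult_nonneg_nonneg prod_nonneg) (use assms in auto)

lemma bexp_nonneg:
  assumes "\<And>e. e \<in> B \<Longrightarrow> 0 \<le> p e \<and> p e \<le> 1" "\<And>\<omega>. \<omega> \<subseteq> B \<Longrightarrow> 0 \<le> F \<omega>"
  shows "0 \<le> bexp B p F"
  unfolding bexp_def
  by (intro sum_nonneg mult_nonneg_nonneg prod_nonneg) (use assms in auto)

lemma bexp_reindex:
  assumes "inj_on g B"
  shows "bexp (g ` B) p F = bexp B (p \<circ> g) (\<lambda>\<omega>. F (g ` \<omega>))"
proof -
  have inj: "inj_on ((`) g) (Pow B)"
    using assms by (meson inj_on_image_Pow)
  have "(\<Prod>e\<in>g ` \<omega>. p e) * (\<Prod>e\<in>g ` B - g ` \<omega>. 1 - p e)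
      = (\<Prod>e\<in>\<omega>. (p \<circ> g) e) * (\<Prod>e\<in>B - \<omega>. 1 - (p \<circ> g) e)" if "\<omega> \<subseteq> B" for \<omega>
  proof -
    have "g ` B - g ` \<omega> = g ` (B - \<omega>)"
      using that assms by (simp add: inj_on_image_set_diff[of g B])
    moreover have "inj_on g \<omega>" "inj_on g (B - \<omega>)"
      using that assms by (auto intro: inj_on_subset)
    ultimately show ?thesis by (simp add: prod.reindex)
  qed
  then show ?thesis
    unfolding bexp_def image_Pow_surj[OF refl, symmetric]
    by (subst sum.reindex[OF inj]) (auto intro!: sum.cong)
qed

definition depends_on :: "'b set \<Rightarrow> ('b set \<Rightarrow> 'c) \<Rightarrow> bool" where
  "depends_on D F \<longleftrightarrow> (\<forall>\<omega>. F \<omega> = F (\<omega> \<inter> D))"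

lemma depends_onI:
  "(\<And>\<omega> \<omega>'. \<omega> \<inter> D = \<omega>' \<inter> D \<Longrightarrow> F \<omega> = F \<omega>') \<Longrightarrow> depends_on D F"
  unfolding depends_on_def by blast

lemma depends_onD: "depends_on D F \<Longrightarrow> \<omega> \<inter> D = \<omega>' \<inter> D \<Longrightarrow> F \<omega> = F \<omega>'"
  unfolding depends_on_def by metis

lemma depends_on_compose: "depends_on D F \<Longrightarrow> depends_on D (\<lambda>\<omega>. h (F \<omega>))"
  unfolding depends_on_def by metis

lemma depends_on_mult:
  fixes F G :: "'b set \<Rightarrow> real"
  shows "depends_on D F \<Longrightarrow> depends_on D' G \<Longrightarrow> depends_on (D \<union> D') (\<lambda>\<omega>. F \<omega> * G \<omega>)"
  by (intro depends_onI arg_cong2[where f = times]; erule depends_onD; blast)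

lemma depends_on_insert:
  assumes "depends_on D F"
  shows "depends_on D (\<lambda>\<omega>. F (insert e \<omega>))"
  by (rule depends_onI, rule depends_onD[OF assms]) blast

lemma bexp_restrict:
  assumes "finite B" "depends_on D F"
  shows "bexp B p F = bexp (B \<inter> D) p F"
  using assms
proof (induction B arbitrary: F rule: finite_induct)
  case (insert e B)
  note IH = insert.IH[OF insert.prems] insert.IH[OF depends_on_insert[OF insert.prems, of e]]
  show ?case
  proof (cases "e \<in> D")
    case True
    then show ?thesis
      using insert.hyps IH by (simp add: bexp_insert)
  next
    case False
    have "F (insert e \<omega>) = F \<omega>" for \<omega>
      by (rule depends_onD[OF insert.prems]) (use False in auto)
    then show ?thesis
      using insert.hyps IH False by (simp add: bexp_insert algebra_simps)
  qed
qed simp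

lemma bexp_indep:
  assumes "finite B" "depends_on D F" "depends_on D' G" "D \<inter> D' = {}"
  shows "bexp B p (\<lambda>\<omega>. F \<omega> * G \<omega>) = bexp B p F * bexp B p G"
  using assms
proof (induction B arbitrary: F G rule: finite_induct)
  case (insert e B)
  note F = insert.prems(1) and G = insert.prems(2) and disj = insert.prems(3)
  note IH = insert.IH[OF F G disj] insert.IH[OF F depends_on_insert[OF G, of e] disj]
    insert.IH[OF depends_on_insert[OF F, of e] G disj]
  consider "e \<notin> D" | "e \<notin> D'" using disj by blast
  then show ?case
  proof cases
    case 1
    have "F (insert e \<omega>) = F \<omega>" for \<omega>
      by (rule depends_onD[OF F]) (use 1 in auto)
    then show ?thesis
      using insert.hyps IH by (simp add: bexp_insert algebra_simps)
  next
    case 2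
    have "G (insert e \<omega>) = G \<omega>" for \<omega>
      by (rule depends_onD[OF G]) (use 2 in auto)
    then show ?thesis
      using insert.hyps IH by (simp add: bexp_insert algebra_simps)
  qed
qed simp

lemma bexp_mem:
  assumes "finite B" "e \<in> B"
  shows "bexp B p (\<lambda>\<omega>. of_bool (e \<in> \<omega>)) = p e"
proof -
  have "bexp (B - {e}) p (\<lambda>\<omega>. of_bool (e \<in> \<omega>)) = bexp (B - {e}) p (\<lambda>_. 0)"
    by (rule bexp_cong) auto
  then have "bexp (insert e (B - {e})) p (\<lambda>\<omega>. of_bool (e \<in> \<omega>)) = p e"
    using assms by (subst bexp_insert) (simp_all add: bexp_const)
  then show ?thesis
    using assms by (simp add: insert_absorb)
qed

definition open_prob :: "('b \<Rightarrow> real) \<Rightarrow> real \<Rightarrow> 'b \<Rightarrow> real" where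
  "open_prob J \<beta> e = 1 - exp (- \<beta> * J e)"

text \<open>Russo's formula. The difference \<open>F (insert e \<omega>) - F \<omega>\<close> vanishes if \<open>e\<close> is open, so the factor
  \<open>exp (- \<beta> * J e)\<close> that comes from the derivative of the opening probability is absorbed as the
  probability that \<open>e\<close> is closed.\<close>
lemma russo:
  assumes "finite B"
  shows "((\<lambda>\<beta>. bexp B (open_prob J \<beta>) F) has_real_derivative
    (\<Sum>e\<in>B. J e * bexp B (open_prob J \<beta>) (\<lambda>\<omega>. F (insert e \<omega>) - F \<omega>))) (at \<beta>)"
  using assms
proof (induction B arbitrary: F rule: finite_induct)
  case (insert e B)
  let ?E = "\<lambda>\<beta>. bexp B (open_prob J \<beta>)"
  let ?E' = "bexp (insert e B) (open_prob J \<beta>)"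
  let ?Fe = "\<lambda>\<omega>. F (insert e \<omega>)"
  let ?D = "\<lambda>F. \<Sum>e\<in>B. J e * ?E \<beta> (\<lambda>\<omega>. F (insert e \<omega>) - F \<omega>)"
  have "((\<lambda>\<beta>. open_prob J \<beta> e * ?E \<beta> ?Fe + (1 - open_prob J \<beta> e) * ?E \<beta> F) has_real_derivative
      J e * (1 - open_prob J \<beta> e) * ?E \<beta> ?Fe + open_prob J \<beta> e * ?D ?Fe
      + (- J e * (1 - open_prob J \<beta> e) * ?E \<beta> F + (1 - open_prob J \<beta> e) * ?D F)) (at \<beta>)"
    unfolding open_prob_def
    by (rule derivative_eq_intros insert.IH[unfolded open_prob_def] refl | simp)+
  also have "J e * (1 - open_prob J \<beta> e) * ?E \<beta> ?Fe + open_prob J \<beta> e * ?D ?Fe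
      + (- J e * (1 - open_prob J \<beta> e) * ?E \<beta> F + (1 - open_prob J \<beta> e) * ?D F)
    = (\<Sum>e\<in>insert e B. J e * ?E' (\<lambda>\<omega>. F (insert e \<omega>) - F \<omega>))"
  proof -
    have "?E' (\<lambda>\<omega>. F (insert e \<omega>) - F \<omega>) = (1 - open_prob J \<beta> e) * (?E \<beta> ?Fe - ?E \<beta> F)"
      using insert.hyps by (simp add: bexp_insert bexp_diff bexp_const right_diff_distrib)
    moreover have "(\<Sum>d\<in>B. J d * ?E' (\<lambda>\<omega>. F (insert d \<omega>) - F \<omega>))
        = open_prob J \<beta> e * ?D ?Fe + (1 - open_prob J \<beta> e) * ?D F"
      using insert.hyps unfolding sum_distrib_left sum.distrib[symmetric]
      by (intro sum.cong) (simp_all add: bexp_insert insert_commute algebra_simps)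
    ultimately show ?thesis
      unfolding sum.insert[OF insert.hyps] by (simp only:) (simp add: algebra_simps)
  qed
  finally show ?case
    using insert.hyps by (simp add: bexp_insert)
qed simp

lemma open_prob_bounds:
  assumes "0 \<le> \<beta>" "0 \<le> J e"
  shows "0 \<le> open_prob J \<beta> e \<and> open_prob J \<beta> e \<le> 1" "open_prob J \<beta> e \<le> \<beta> * J e"
  using assms exp_ge_add_one_self[of "- \<beta> * J e"] by (auto simp: open_prob_def)

lemma bexp_open_prob_mono:
  assumes "finite B" "\<And>e. e \<in> B \<Longrightarrow> 0 \<le> J e" "0 \<le> \<beta>" "\<beta> \<le> \<beta>'"
    and mono: "\<And>\<omega> \<omega>'. \<omega> \<subseteq> \<omega>' \<Longrightarrow> F \<omega> \<le> F \<omega>'"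
  shows "bexp B (open_prob J \<beta>) F \<le> bexp B (open_prob J \<beta>') F"
proof (rule DERIV_nonneg_imp_nondecreasing[OF assms(4)])
  fix b assume "\<beta> \<le> b" "b \<le> \<beta>'"
  then have "0 \<le> b" using assms by simp
  then have "\<And>e. e \<in> B \<Longrightarrow> 0 \<le> open_prob J b e \<and> open_prob J b e \<le> 1"
    using assms(2) by (rule open_prob_bounds(1))
  then have "0 \<le> (\<Sum>e\<in>B. J e * bexp B (open_prob J b) (\<lambda>\<omega>. F (insert e \<omega>) - F \<omega>))"
    by (intro sum_nonneg mult_nonneg_nonneg bexp_nonneg)
      (use assms(2) in \<open>auto intro!: mono\<close>)
  with russo[OF assms(1)]
  show "\<exists>y. ((\<lambda>\<beta>. bexp B (open_prob J \<beta>) F) has_real_derivative y) (at b) \<and> 0 \<le> y"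
    by blast
qed


section \<open>Clusters and the bonds that determine them\<close>

abbreviation cl :: "'v set \<Rightarrow> 'v bond set \<Rightarrow> 'v \<Rightarrow> 'v set" where
  "cl L \<omega> x \<equiv> cluster L (\<lambda>e. e \<in> \<omega>) x"

definition links :: "'v \<Rightarrow> 'v \<Rightarrow> 'v bond set" where
  "links y z = {Unoriented {y, z}, Oriented y z}"

lemma open_step_iff:
  "(u, v) \<in> open_step L (\<lambda>e. e \<in> \<omega>) \<longleftrightarrow> u \<in> L \<and> v \<in> L \<and> u \<noteq> v \<and> \<omega> \<inter> links u v \<noteq> {}"
  by (auto simp: open_step_def links_def)

lemma links_subset_bonds: "u \<in> L \<Longrightarrow> v \<in> L \<Longrightarrow> u \<noteq> v \<Longrightarrow> links u v \<subseteq> bonds L"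
  by (auto simp: bonds_def links_def)

lemma links_disjoint_bonds: "u \<notin> L \<or> v \<notin> L \<Longrightarrow> links u v \<inter> bonds L = {}"
  by (auto simp: bonds_def links_def doubleton_eq_iff)

lemma finite_bonds: "finite L \<Longrightarrow> finite (bonds L)"
  by (rule finite_subset[of _ "(\<Union>x\<in>L. \<Union>y\<in>L. links x y)"])
    (auto simp: bonds_def links_def)

lemma bonds_mono: "L \<subseteq> M \<Longrightarrow> bonds L \<subseteq> bonds M"
  by (auto simp: bonds_def)

lemma cluster_eq_Image: "cluster L \<omega> x = (open_step L \<omega>)\<^sup>* `` {x}"
  by (auto simp: cluster_def)

lemma cl_mono: "L \<subseteq> M \<Longrightarrow> \<omega> \<subseteq> \<omega>' \<Longrightarrow> cl L \<omega> x \<subseteq> cl M \<omega>' x"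
  unfolding cluster_eq_Image
  by (intro Image_mono rtrancl_mono) (auto simp: open_step_def)

lemma cl_trans: "y \<in> cl L \<omega> x \<Longrightarrow> cl L \<omega> y \<subseteq> cl L \<omega> x"
  by (auto simp: cluster_def)

lemma cl_step: "y \<in> cl L \<omega> x \<Longrightarrow> (y, z) \<in> open_step L (\<lambda>e. e \<in> \<omega>) \<Longrightarrow> z \<in> cl L \<omega> x"
  by (auto simp: cluster_def intro: rtrancl_into_rtrancl)

lemma cl_refl: "x \<in> cl L \<omega> x"
  by (simp add: cluster_def)

text \<open>Exploration principle: the set reached from \<open>W\<close> is decided by the steps that leave its own
  points. It is used below forwards, for clusters, and backwards, for the set of vertices that reach
  a given set.\<close>
lemma rtrancl_Image_agree:
  assumes "\<And>u v. u \<in> R\<^sup>* `` W \<Longrightarrow> (u, v) \<in> R \<longleftrightarrow> (u, v) \<in> R'"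
  shows "R'\<^sup>* `` W = R\<^sup>* `` W"
proof -
  have "y \<in> R'\<^sup>* `` W" if "(x, y) \<in> R\<^sup>*" "x \<in> W" for x y
    using that
  proof (induction rule: rtrancl_induct)
    case (step u v)
    then have "(u, v) \<in> R'" using assms by blast
    with step show ?case by (blast intro: rtrancl_into_rtrancl)
  qed blast
  moreover have "y \<in> R\<^sup>* `` W" if "(x, y) \<in> R'\<^sup>*" "x \<in> W" for x y
    using that
  proof (induction rule: rtrancl_induct)
    case (step u v)
    then have "(u, v) \<in> R" using assms by blast
    with step show ?case by (blast intro: rtrancl_into_rtrancl)
  qed blast
  ultimately show ?thesis by blast
qed

lemma depends_on_cl: "depends_on (bonds L) (\<lambda>\<omega>. cl L \<omega> x)"
proof (rule depends_onI)
  fix \<omega> \<omega>' assume "\<omega> \<inter> bonds L = \<omega>' \<inter> bonds L"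
  then have "open_step L (\<lambda>e. e \<in> \<omega>) = open_step L (\<lambda>e. e \<in> \<omega>')"
    using links_subset_bonds by (fastforce simp: open_step_iff)
  then show "cl L \<omega> x = cl L \<omega>' x"
    by (simp add: cluster_def)
qed

text \<open>The bonds that do not touch \<open>A\<close> remain unexplored when the cluster turns out to be \<open>A\<close>.\<close>
lemma depends_on_cl_eq:
  assumes "x \<in> S"
  shows "depends_on (bonds S - bonds (S - A)) (\<lambda>\<omega>. cl S \<omega> x = A)"
proof -
  have "cl S \<omega>' x = A"
    if agree: "\<omega> \<inter> (bonds S - bonds (S - A)) = \<omega>' \<inter> (bonds S - bonds (S - A))"
      and A: "cl S \<omega> x = A" for \<omega> \<omega>'
  proof -
    have "(u, v) \<in> open_step S (\<lambda>e. e \<in> \<omega>) \<longleftrightarrow> (u, v) \<in> open_step S (\<lambda>e. e \<in> \<omega>')"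
      if "u \<in> A" for u v
    proof (cases "u \<in> S \<and> v \<in> S \<and> u \<noteq> v")
      case True
      then have "links u v \<subseteq> bonds S - bonds (S - A)"
        using links_subset_bonds[of u S v] links_disjoint_bonds[of u "S - A" v] that by auto
      with agree have "\<omega> \<inter> links u v = \<omega>' \<inter> links u v" by blast
      then show ?thesis by (simp add: open_step_iff)
    qed (auto simp: open_step_iff)
    then show ?thesis
      using rtrancl_Image_agree[of "open_step S (\<lambda>e. e \<in> \<omega>)" "{x}"] A
      unfolding cluster_eq_Image by metis
  qed
  then show ?thesis
    by (intro depends_onI) metis
qed

text \<open>The complement of the set explored backwards from \<open>M - L\<close>. If \<open>x\<close> is trapped then this is the
  set \<open>S\<close> whose exits are pivotal for the escape of \<open>x\<close> from \<open>L\<close>.\<close>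
definition trapped :: "'v set \<Rightarrow> 'v set \<Rightarrow> 'v bond set \<Rightarrow> 'v set" where
  "trapped L M \<omega> = {y \<in> L. cl M \<omega> y \<subseteq> L}"

text \<open>The backward exploration only uses bonds with an endpoint outside the trapped set, so
  the bonds inside it stay independent.\<close>
lemma depends_on_trapped_eq:
  assumes "L \<subseteq> M"
  shows "depends_on (bonds M - bonds S) (\<lambda>\<omega>. trapped L M \<omega> = S)"
proof -
  have tr: "trapped L M \<omega> = M - ((open_step M (\<lambda>e. e \<in> \<omega>))\<inverse>)\<^sup>* `` (M - L)" for \<omega>
    using assms cluster_subset[of _ M]
    unfolding trapped_def by (fastforce simp: cluster_def rtrancl_converse)
  have "trapped L M \<omega>' = S"
    if agree: "\<omega> \<inter> (bonds M - bonds S) = \<omega>' \<inter> (bonds M - bonds S)"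
      and S: "trapped L M \<omega> = S" for \<omega> \<omega>'
  proof -
    have "(u, v) \<in> (open_step M (\<lambda>e. e \<in> \<omega>))\<inverse> \<longleftrightarrow> (u, v) \<in> (open_step M (\<lambda>e. e \<in> \<omega>'))\<inverse>"
      if u: "u \<in> ((open_step M (\<lambda>e. e \<in> \<omega>))\<inverse>)\<^sup>* `` (M - L)" for u v
    proof (cases "u \<in> M \<and> v \<in> M \<and> v \<noteq> u")
      case True
      then have "u \<notin> S" using u S tr[of \<omega>] by blast
      then have "links v u \<subseteq> bonds M - bonds S"
        using links_subset_bonds[of v M u] links_disjoint_bonds[of v S u] True by auto
      with agree have "\<omega> \<inter> links v u = \<omega>' \<inter> links v u" by blast
      then show ?thesis by (simp add: open_step_iff)
    qed (auto simp: open_step_iff)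
    then show ?thesis
      using rtrancl_Image_agree[of "(open_step M (\<lambda>e. e \<in> \<omega>))\<inverse>" "M - L"] S
      unfolding tr by metis
  qed
  then show ?thesis
    by (intro depends_onI) metis
qed

text \<open>Split a path to \<open>u\<close> at its last vertex \<open>y\<close> in the cluster of \<open>x\<close> inside \<open>S\<close>. The next vertex \<open>z\<close>
  is not in \<open>S\<close>, as it would otherwise belong to that cluster, and the rest of the path avoids
  the cluster.\<close>
lemma cl_exit:
  assumes "x \<in> S" "S \<subseteq> L" "u \<in> cl L \<omega> x" "u \<notin> cl S \<omega> x"
  shows "\<exists>y\<in>cl S \<omega> x. \<exists>z\<in>L - S. \<omega> \<inter> links y z \<noteq> {} \<and> u \<in> cl (L - cl S \<omega> x) \<omega> z"
proof -
  let ?A = "cl S \<omega> x"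
  let ?Q = "\<lambda>u. \<exists>y\<in>?A. \<exists>z\<in>L - S. \<omega> \<inter> links y z \<noteq> {} \<and> u \<in> cl (L - ?A) \<omega> z"
  have "(x, u) \<in> (open_step L (\<lambda>e. e \<in> \<omega>))\<^sup>*"
    using assms(3) by (simp add: cluster_def)
  then have "u \<in> ?A \<or> ?Q u"
  proof (induction rule: rtrancl_induct)
    case base
    then show ?case by (simp add: cl_refl)
  next
    case (step u v)
    have uv: "u \<in> L" "v \<in> L" "u \<noteq> v" "\<omega> \<inter> links u v \<noteq> {}"
      using step.hyps(2) by (auto simp: open_step_iff)
    consider "v \<in> ?A" | "u \<in> ?A" "v \<notin> ?A" | "u \<notin> ?A" "v \<notin> ?A" by blast
    then show ?case
    proof cases
      case 2
      then have "v \<notin> S"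
        using cl_step[of u S \<omega> x v] uv cluster_subset[OF assms(1)] by (auto simp: open_step_iff)
      then have "?Q v" using 2 uv cl_refl by fast
      then show ?thesis by blast
    next
      case 3
      then obtain y z where yz: "y \<in> ?A" "z \<in> L - S" "\<omega> \<inter> links y z \<noteq> {}" "u \<in> cl (L - ?A) \<omega> z"
        using step.IH by blast
      have "v \<in> cl (L - ?A) \<omega> z"
        by (rule cl_step[OF yz(4)]) (use 3 uv in \<open>simp add: open_step_iff\<close>)
      then show ?thesis using yz by blast
    qed blast
  qed
  with assms(4) show ?thesis by blast
qed


section \<open>Exploring a cluster from inside\<close>

definition pair_rate :: "('v bond \<Rightarrow> real) \<Rightarrow> 'v \<Rightarrow> 'v \<Rightarrow> real" where
  "pair_rate J y z = (if y = z then 0 else J (Unoriented {y, z}) + J (Oriented y z))"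

definition out_rate :: "('v bond \<Rightarrow> real) \<Rightarrow> 'v \<Rightarrow> 'v set \<Rightarrow> real" where
  "out_rate J y W = (\<Sum>\<^sub>\<infinity>z\<in>W. pair_rate J y z)"

text \<open>The quantity \<open>\<phi>(S)\<close> of Duminil-Copin and Tassion, with rates in place of opening
  probabilities: rates are what Russo's formula produces, and \<open>\<beta>\<close> times the rate bounds the
  opening probability. The ambient set \<open>U\<close> is the whole vertex set or a finite volume.\<close>
definition flux :: "'v set \<Rightarrow> ('v bond \<Rightarrow> real) \<Rightarrow> real \<Rightarrow> 'v set \<Rightarrow> 'v \<Rightarrow> real" where
  "flux U J \<beta> S x = (\<Sum>y\<in>S. bexp (bonds S) (open_prob J \<beta>) (\<lambda>\<omega>. of_bool (y \<in> cl S \<omega> x))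
      * out_rate J y (U - S))"

lemma bonds_Int: "bonds A \<inter> bonds B \<subseteq> bonds (A \<inter> B)"
  by (auto simp: bonds_def doubleton_eq_iff) blast+

lemma sum_of_bool_eq:
  fixes g :: "'a \<Rightarrow> real"
  assumes "finite A" "c \<in> A"
  shows "(\<Sum>a\<in>A. of_bool (c = a) * g a) = g c"
proof -
  have "(\<Sum>a\<in>A. of_bool (c = a) * g a) = (\<Sum>a\<in>A. if c = a then g a else 0)"
    by (rule sum.cong) auto
  then show ?thesis using assms by simp
qed

locale percolation =
  fixes V :: "'v set" and J :: "'v bond \<Rightarrow> real"
  assumes pos: "e \<in> bonds V \<Longrightarrow> 0 < J e"
    and summable: "x \<in> V \<Longrightarrow> pair_rate J x summable_on V"
begin

lemma pair_rate_nonneg: "y \<in> V \<Longrightarrow> z \<in> V \<Longrightarrow> 0 \<le> pair_rate J y z"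
  using pos links_subset_bonds[of y V z] by (auto simp: pair_rate_def links_def add_nonneg_nonneg less_imp_le)

lemma J_nonneg: "L \<subseteq> V \<Longrightarrow> e \<in> bonds L \<Longrightarrow> 0 \<le> J e"
  using pos bonds_mono by (meson less_imp_le subsetD)

lemma prob_bounds:
  "L \<subseteq> V \<Longrightarrow> 0 \<le> \<beta> \<Longrightarrow> e \<in> bonds L \<Longrightarrow> 0 \<le> open_prob J \<beta> e \<and> open_prob J \<beta> e \<le> 1"
  using open_prob_bounds(1) J_nonneg by metis

lemma out_rate_nonneg: "y \<in> V \<Longrightarrow> W \<subseteq> V \<Longrightarrow> 0 \<le> out_rate J y W"
  unfolding out_rate_def by (intro infsum_nonneg pair_rate_nonneg) auto

lemma sum_pair_rate_le_out_rate:
  "y \<in> V \<Longrightarrow> F \<subseteq> W \<Longrightarrow> W \<subseteq> V \<Longrightarrow> finite F \<Longrightarrow> sum (pair_rate J y) F \<le> out_rate J y W"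
  unfolding out_rate_def
  by (intro finite_sum_le_infsum)
    (auto intro: pair_rate_nonneg summable_on_subset_banach[OF summable])

lemma prob_link_le:
  assumes "L \<subseteq> V" "finite L" "0 \<le> \<beta>" "y \<in> L" "z \<in> L" "y \<noteq> z"
  shows "bexp (bonds L) (open_prob J \<beta>) (\<lambda>\<omega>. of_bool (\<omega> \<inter> links y z \<noteq> {})) \<le> \<beta> * pair_rate J y z"
proof -
  let ?E = "bexp (bonds L) (open_prob J \<beta>)"
  have mem: "Unoriented {y, z} \<in> bonds L" "Oriented y z \<in> bonds L"
    using links_subset_bonds[OF assms(4-6)] by (auto simp: links_def)
  have "?E (\<lambda>\<omega>. of_bool (\<omega> \<inter> links y z \<noteq> {}))
      \<le> ?E (\<lambda>\<omega>. of_bool (Unoriented {y, z} \<in> \<omega>) + of_bool (Oriented y z \<in> \<omega>))"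
    by (rule bexp_mono[OF prob_bounds[OF assms(1,3)]]) (auto simp: links_def)
  also have "\<dots> = open_prob J \<beta> (Unoriented {y, z}) + open_prob J \<beta> (Oriented y z)"
    by (simp add: bexp_add bexp_mem finite_bonds assms mem)
  also have "\<dots> \<le> \<beta> * J (Unoriented {y, z}) + \<beta> * J (Oriented y z)"
    by (intro add_mono open_prob_bounds(2) assms J_nonneg[OF assms(1)] mem)
  finally show ?thesis using assms(6) by (simp add: pair_rate_def distrib_left)
qed

text \<open>One generation of the branching comparison. Conditionally on the cluster \<open>A\<close> of \<open>x\<close> inside
  \<open>S\<close>, an exit \<open>y, z\<close> and the cluster of \<open>z\<close> in the complement of \<open>A\<close> depend on disjoint sets of
  unexplored bonds.\<close>
lemma expected_volume_step:
  assumes L: "L \<subseteq> V" "finite L" and S: "S \<subseteq> V" "finite S" "x \<in> S" "x \<in> L"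
    and \<beta>: "0 \<le> \<beta>" and m0: "0 \<le> m"
    and m: "\<And>z. z \<in> L \<Longrightarrow> bexp (bonds L) (open_prob J \<beta>) (\<lambda>\<omega>. real (card (cl L \<omega> z))) \<le> m"
  shows "bexp (bonds L) (open_prob J \<beta>) (\<lambda>\<omega>. real (card (cl L \<omega> x)))
    \<le> real (card S) + \<beta> * flux V J \<beta> S x * m"
proof -
  let ?E = "bexp (bonds L) (open_prob J \<beta>)"
  \<comment> \<open>The set \<open>S\<close> need not lie in the volume \<open>L\<close>; inside \<open>L\<close> only its trace is explored.\<close>
  define T where "T = S \<inter> L"
  have T: "T \<subseteq> L" "T \<subseteq> S" "T \<subseteq> V" "finite T" "x \<in> T"
    using S L by (auto simp: T_def)
  note mono = bexp_mono[OF prob_bounds[OF L(1) \<beta>]]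
  let ?f = "\<lambda>A y z \<omega>. of_bool (cl T \<omega> x = A) *
      (of_bool (\<omega> \<inter> links y z \<noteq> {}) * real (card (cl (L - A) \<omega> z)))"
  have pointwise: "real (card (cl L \<omega> x))
      \<le> real (card S) + (\<Sum>A\<in>Pow T. \<Sum>y\<in>A. \<Sum>z\<in>L - T. ?f A y z \<omega>)" for \<omega>
  proof -
    define A where "A = cl T \<omega> x"
    have A: "A \<subseteq> T" "finite A"
      unfolding A_def
      using cluster_subset[OF T(5)] finite_subset[OF cluster_subset[OF T(5)] T(4)] by auto
    let ?C = "\<lambda>y z. if \<omega> \<inter> links y z \<noteq> {} then cl (L - A) \<omega> z else {}"
    have fin: "finite (?C y z)" if "z \<in> L - T" for y z
    proof -
      have "z \<in> L - A" using that A by auto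
      from cluster_subset[OF this] show ?thesis using L(2) finite_subset by fastforce
    qed
    have "cl L \<omega> x \<subseteq> A \<union> (\<Union>y\<in>A. \<Union>z\<in>L - T. ?C y z)"
      using cl_exit[OF T(5,1)] unfolding A_def by fastforce
    then have "card (cl L \<omega> x) \<le> card (A \<union> (\<Union>y\<in>A. \<Union>z\<in>L - T. ?C y z))"
      by (intro card_mono finite_UnI finite_UN_I fin A(2) finite_Diff L(2))
    also have "\<dots> \<le> card A + card (\<Union>y\<in>A. \<Union>z\<in>L - T. ?C y z)"
      by (rule card_Un_le)
    also have "\<dots> \<le> card S + (\<Sum>y\<in>A. \<Sum>z\<in>L - T. card (?C y z))"
    proof (rule add_mono)
      show "card A \<le> card S" using A T S by (intro card_mono) auto
      show "card (\<Union>y\<in>A. \<Union>z\<in>L - T. ?C y z) \<le> (\<Sum>y\<in>A. \<Sum>z\<in>L - T. card (?C y z))"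
        by (rule order_trans[OF card_UN_le[OF A(2)]], intro sum_mono card_UN_le finite_Diff L(2))
    qed
    finally have "real (card (cl L \<omega> x)) \<le> real (card S + (\<Sum>y\<in>A. \<Sum>z\<in>L - T. card (?C y z)))"
      by (rule of_nat_mono)
    also have "\<dots> = real (card S) + (\<Sum>y\<in>A. \<Sum>z\<in>L - T.
        of_bool (\<omega> \<inter> links y z \<noteq> {}) * real (card (cl (L - A) \<omega> z)))"
      by (auto intro!: sum.cong)
    also have "(\<Sum>y\<in>A. \<Sum>z\<in>L - T. of_bool (\<omega> \<inter> links y z \<noteq> {}) * real (card (cl (L - A) \<omega> z)))
        = (\<Sum>B\<in>Pow T. of_bool (A = B) * (\<Sum>y\<in>B. \<Sum>z\<in>L - T.
          of_bool (\<omega> \<inter> links y z \<noteq> {}) * real (card (cl (L - B) \<omega> z))))"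
      using A T by (subst sum_of_bool_eq) auto
    finally show ?thesis
      by (simp add: A_def sum_distrib_left)
  qed
  have factor: "?E (?f A y z) \<le> ?E (\<lambda>\<omega>. of_bool (cl T \<omega> x = A) * (\<beta> * pair_rate J y z * m))"
    if A: "A \<in> Pow T" and y: "y \<in> A" and z: "z \<in> L - T" for A y z
  proof -
    let ?D = "bonds T - bonds (T - A)"
    have dep1: "depends_on ?D (\<lambda>\<omega>. of_bool (cl T \<omega> x = A) :: real)"
      by (rule depends_on_compose[OF depends_on_cl_eq[OF T(5)]])
    have dep2: "depends_on (links y z) (\<lambda>\<omega>. of_bool (\<omega> \<inter> links y z \<noteq> {}) :: real)"
      by (rule depends_onI) simp
    have dep3: "depends_on (bonds (L - A)) (\<lambda>\<omega>. real (card (cl (L - A) \<omega> z)))"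
      by (rule depends_on_compose[OF depends_on_cl])
    have d23: "links y z \<inter> bonds (L - A) = {}"
      using y by (intro links_disjoint_bonds) auto
    have "links y z \<inter> bonds T = {}"
      using z by (intro links_disjoint_bonds) auto
    moreover have "bonds T \<inter> bonds (L - A) \<subseteq> bonds (T - A)"
    proof -
      have "T \<inter> (L - A) = T - A" using T by auto
      then show ?thesis using bonds_Int[of T "L - A"] by simp
    qed
    ultimately have d1: "?D \<inter> (links y z \<union> bonds (L - A)) = {}"
      by blast
    have link: "?E (\<lambda>\<omega>. of_bool (\<omega> \<inter> links y z \<noteq> {})) \<le> \<beta> * pair_rate J y z"
      using A y z T by (intro prob_link_le L \<beta>) auto
    have "?E (\<lambda>\<omega>. real (card (cl (L - A) \<omega> z))) \<le> ?E (\<lambda>\<omega>. real (card (cl L \<omega> z)))"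
    proof (rule mono)
      fix \<omega>
      show "real (card (cl (L - A) \<omega> z)) \<le> real (card (cl L \<omega> z))"
        using cl_mono[of "L - A" L \<omega> \<omega> z] cluster_subset[of z L] z L(2) finite_subset
        by (intro of_nat_mono card_mono) blast+
    qed auto
    also have "\<dots> \<le> m" using m z by simp
    finally have vol: "?E (\<lambda>\<omega>. real (card (cl (L - A) \<omega> z))) \<le> m" .
    have "?E (?f A y z) = ?E (\<lambda>\<omega>. of_bool (cl T \<omega> x = A)) *
        (?E (\<lambda>\<omega>. of_bool (\<omega> \<inter> links y z \<noteq> {})) * ?E (\<lambda>\<omega>. real (card (cl (L - A) \<omega> z))))"
      using finite_bonds[OF L(2)]
      by (simp only: bexp_indep[OF _ dep1 depends_on_mult[OF dep2 dep3] d1]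
          bexp_indep[OF _ dep2 dep3 d23])
    also have "\<dots> \<le> ?E (\<lambda>\<omega>. of_bool (cl T \<omega> x = A)) * (\<beta> * pair_rate J y z * m)"
      using A y z T L m0 \<beta>
      by (intro mult_left_mono mult_mono link vol bexp_nonneg[OF prob_bounds[OF L(1) \<beta>]]
          mult_nonneg_nonneg pair_rate_nonneg) auto
    also have "\<dots> = ?E (\<lambda>\<omega>. of_bool (cl T \<omega> x = A) * (\<beta> * pair_rate J y z * m))"
      by (subst (2) mult.commute) (simp only: bexp_cmult mult.commute)
    finally show ?thesis .
  qed
  have "?E (\<lambda>\<omega>. real (card (cl L \<omega> x)))
      \<le> ?E (\<lambda>\<omega>. real (card S) + (\<Sum>A\<in>Pow T. \<Sum>y\<in>A. \<Sum>z\<in>L - T. ?f A y z \<omega>))"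
    by (rule mono[OF _ pointwise])
  also have "\<dots> = real (card S) + (\<Sum>A\<in>Pow T. \<Sum>y\<in>A. \<Sum>z\<in>L - T. ?E (?f A y z))"
    by (simp only: bexp_add bexp_sum bexp_const[OF finite_bonds[OF L(2)]])
  also have "\<dots> \<le> real (card S) + (\<Sum>A\<in>Pow T. \<Sum>y\<in>A. \<Sum>z\<in>L - T.
      ?E (\<lambda>\<omega>. of_bool (cl T \<omega> x = A) * (\<beta> * pair_rate J y z * m)))"
    by (intro add_left_mono sum_mono factor)
  also have "(\<Sum>A\<in>Pow T. \<Sum>y\<in>A. \<Sum>z\<in>L - T.
      ?E (\<lambda>\<omega>. of_bool (cl T \<omega> x = A) * (\<beta> * pair_rate J y z * m)))
    = ?E (\<lambda>\<omega>. \<Sum>A\<in>Pow T. of_bool (cl T \<omega> x = A) * (\<Sum>y\<in>A. \<Sum>z\<in>L - T. \<beta> * pair_rate J y z * m))"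
    by (simp only: bexp_sum sum_distrib_left)
  also have "\<dots> = ?E (\<lambda>\<omega>. \<Sum>y\<in>T. (\<Sum>z\<in>L - T. \<beta> * pair_rate J y z * m) * of_bool (y \<in> cl T \<omega> x))"
  proof (rule bexp_cong)
    fix \<omega>
    have sub: "cl T \<omega> x \<subseteq> T" using cluster_subset[OF T(5)] .
    have "(\<Sum>A\<in>Pow T. of_bool (cl T \<omega> x = A) * (\<Sum>y\<in>A. \<Sum>z\<in>L - T. \<beta> * pair_rate J y z * m))
        = (\<Sum>y\<in>cl T \<omega> x. \<Sum>z\<in>L - T. \<beta> * pair_rate J y z * m)"
      using sub T by (intro sum_of_bool_eq) auto
    also have "\<dots> = (\<Sum>y\<in>T. (\<Sum>z\<in>L - T. \<beta> * pair_rate J y z * m) * of_bool (y \<in> cl T \<omega> x))"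
      using sub T by (intro sum.mono_neutral_cong_left) auto
    finally show "(\<Sum>A\<in>Pow T. of_bool (cl T \<omega> x = A) * (\<Sum>y\<in>A. \<Sum>z\<in>L - T. \<beta> * pair_rate J y z * m))
        = (\<Sum>y\<in>T. (\<Sum>z\<in>L - T. \<beta> * pair_rate J y z * m) * of_bool (y \<in> cl T \<omega> x))" .
  qed
  also have "\<dots> = (\<Sum>y\<in>T. (\<Sum>z\<in>L - T. \<beta> * pair_rate J y z * m) * ?E (\<lambda>\<omega>. of_bool (y \<in> cl T \<omega> x)))"
    by (simp only: bexp_sum bexp_cmult)
  also have "\<dots> \<le> (\<Sum>y\<in>T. (\<beta> * m * out_rate J y (V - S)) *
      bexp (bonds S) (open_prob J \<beta>) (\<lambda>\<omega>. of_bool (y \<in> cl S \<omega> x)))"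
  proof (rule sum_mono)
    fix y assume y: "y \<in> T"
    then have yV: "y \<in> V" using T by auto
    have dep: "depends_on (bonds T) (\<lambda>\<omega>. of_bool (y \<in> cl T \<omega> x) :: real)"
      by (rule depends_on_compose[OF depends_on_cl])
    have "?E (\<lambda>\<omega>. of_bool (y \<in> cl T \<omega> x)) = bexp (bonds T) (open_prob J \<beta>) (\<lambda>\<omega>. of_bool (y \<in> cl T \<omega> x))"
      using bexp_restrict[OF finite_bonds[OF L(2)] dep] bonds_mono[OF T(1)]
      by (simp add: Int_absorb1)
    also have "\<dots> = bexp (bonds S) (open_prob J \<beta>) (\<lambda>\<omega>. of_bool (y \<in> cl T \<omega> x))"
      using bexp_restrict[OF finite_bonds[OF S(2)] dep] bonds_mono[OF T(2)]
      by (simp add: Int_absorb1)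
    also have "\<dots> \<le> bexp (bonds S) (open_prob J \<beta>) (\<lambda>\<omega>. of_bool (y \<in> cl S \<omega> x))"
      using cl_mono[OF T(2) order_refl]
      by (intro bexp_mono[OF prob_bounds[OF S(1) \<beta>]]) auto
    finally have p: "?E (\<lambda>\<omega>. of_bool (y \<in> cl T \<omega> x))
        \<le> bexp (bonds S) (open_prob J \<beta>) (\<lambda>\<omega>. of_bool (y \<in> cl S \<omega> x))" .
    have "(\<Sum>z\<in>L - T. \<beta> * pair_rate J y z * m) = \<beta> * m * sum (pair_rate J y) (L - T)"
      by (simp add: sum_distrib_left mult_ac)
    also have "\<dots> \<le> \<beta> * m * out_rate J y (V - S)"
      using \<beta> m0 L T_def by (intro mult_left_mono sum_pair_rate_le_out_rate yV) auto
    finally show "(\<Sum>z\<in>L - T. \<beta> * pair_rate J y z * m) * ?E (\<lambda>\<omega>. of_bool (y \<in> cl T \<omega> x))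
      \<le> (\<beta> * m * out_rate J y (V - S)) *
        bexp (bonds S) (open_prob J \<beta>) (\<lambda>\<omega>. of_bool (y \<in> cl S \<omega> x))"
      using \<beta> m0
      by (intro mult_mono p mult_nonneg_nonneg out_rate_nonneg yV
          bexp_nonneg[OF prob_bounds[OF L(1) \<beta>]]) auto
  qed
  also have "\<dots> \<le> (\<Sum>y\<in>S. (\<beta> * m * out_rate J y (V - S)) *
      bexp (bonds S) (open_prob J \<beta>) (\<lambda>\<omega>. of_bool (y \<in> cl S \<omega> x)))"
    using \<beta> m0 S T
    by (intro sum_mono2 mult_nonneg_nonneg out_rate_nonneg
        bexp_nonneg[OF prob_bounds[OF S(1) \<beta>]]) auto
  also have "\<dots> = \<beta> * flux V J \<beta> S x * m"
    by (simp add: flux_def sum_distrib_left sum_distrib_right mult_ac)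
  finally show ?thesis by simp
qed

text \<open>In a finite volume the maximal expected cluster size \<open>m\<close> is a finite number, so
  \<open>m \<le> N + (1 - d) * m\<close> can be solved for \<open>m\<close>; the bound does not depend on the volume.\<close>
lemma expected_volume_bound:
  assumes \<beta>: "0 \<le> \<beta>" and d: "0 < d" and L: "L \<subseteq> V" "finite L"
    and flux: "\<And>x. x \<in> V \<Longrightarrow> \<exists>S. finite S \<and> S \<subseteq> V \<and> x \<in> S \<and> card S \<le> N \<and> \<beta> * flux V J \<beta> S x \<le> 1 - d"
    and x: "x \<in> L"
  shows "bexp (bonds L) (open_prob J \<beta>) (\<lambda>\<omega>. real (card (cl L \<omega> x))) \<le> real N / d"
proof -
  let ?M = "\<lambda>z. bexp (bonds L) (open_prob J \<beta>) (\<lambda>\<omega>. real (card (cl L \<omega> z)))"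
  define m where "m = Max (?M ` L)"
  have m: "?M z \<le> m" if "z \<in> L" for z
    using that L by (simp add: m_def)
  have "0 \<le> ?M x"
    by (intro bexp_nonneg[OF prob_bounds[OF L(1) \<beta>]]) auto
  then have m0: "0 \<le> m" using m[OF x] by simp
  have "m \<in> ?M ` L"
    unfolding m_def using x L by (intro Max_in) auto
  then obtain z where z: "z \<in> L" "m = ?M z" by blast
  then obtain S where S: "finite S" "S \<subseteq> V" "z \<in> S" "card S \<le> N" "\<beta> * flux V J \<beta> S z \<le> 1 - d"
    using flux L by blast
  have "m \<le> real (card S) + \<beta> * flux V J \<beta> S z * m"
    unfolding z(2) using expected_volume_step[OF L S(2,1,3) z(1) \<beta> m0 m] z(2) by simp
  also have "\<dots> \<le> real N + (1 - d) * m"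
    using S m0 by (intro add_mono mult_right_mono) auto
  finally have "m \<le> real N / d"
    using d by (simp add: field_simps)
  with m[OF x] show ?thesis by simp
qed


end


section \<open>Growth of the escape probability\<close>

context percolation
begin

text \<open>The right-hand side is the derivative of the escape probability by Russo's formula. If \<open>x\<close>
  is trapped, say with trapped set \<open>S\<close>, then opening a bond from a vertex of its cluster in \<open>S\<close>
  to a vertex outside \<open>S\<close> lets it escape.\<close>
lemma escape_influence:
  assumes L: "x \<in> L" "L \<subseteq> M" "M \<subseteq> V" "finite M" and \<beta>: "0 \<le> \<beta>"
    and c: "\<And>S. S \<subseteq> L \<Longrightarrow> x \<in> S \<Longrightarrow> c \<le> flux M J \<beta> S x"
  defines "F \<equiv> \<lambda>\<omega>. of_bool (\<not> cl M \<omega> x \<subseteq> L) :: real"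
  shows "c * (1 - bexp (bonds M) (open_prob J \<beta>) F)
    \<le> (\<Sum>e\<in>bonds M. J e * bexp (bonds M) (open_prob J \<beta>) (\<lambda>\<omega>. F (insert e \<omega>) - F \<omega>))"
proof -
  let ?E = "bexp (bonds M) (open_prob J \<beta>)"
  let ?P = "{S \<in> Pow L. x \<in> S}"
  let ?g = "\<lambda>\<omega> S. \<Sum>y\<in>S. of_bool (y \<in> cl S \<omega> x) * out_rate J y (M - S)"
  have fin: "finite L" "finite ?P" "finite (bonds M)"
    using L finite_subset[of L M] finite_bonds by auto
  have F_mono: "F \<omega> \<le> F (insert e \<omega>)" for \<omega> e
    using cl_mono[OF order_refl, of \<omega> "insert e \<omega>" M x] by (auto simp: F_def)
  have pointwise: "(\<Sum>S\<in>?P. of_bool (trapped L M \<omega> = S) * ?g \<omega> S)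
      \<le> (\<Sum>e\<in>bonds M. J e * (F (insert e \<omega>) - F \<omega>))" for \<omega>
  proof (cases "cl M \<omega> x \<subseteq> L")
    case False
    then have "x \<notin> trapped L M \<omega>" by (simp add: trapped_def)
    then have "(\<Sum>S\<in>?P. of_bool (trapped L M \<omega> = S) * ?g \<omega> S) = 0"
      by (intro sum.neutral) auto
    also have "0 \<le> (\<Sum>e\<in>bonds M. J e * (F (insert e \<omega>) - F \<omega>))"
      using F_mono J_nonneg[OF L(3)] by (intro sum_nonneg mult_nonneg_nonneg) auto
    finally show ?thesis .
  next
    case True
    define S where "S = trapped L M \<omega>"
    have S: "S \<subseteq> L" "x \<in> S" "finite S"
      using True L fin finite_subset[of S L] by (auto simp: S_def trapped_def)
    define Q where "Q = (S \<inter> cl S \<omega> x) \<times> (M - S)"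
    have QD: "y \<in> S \<and> y \<in> cl S \<omega> x \<and> z \<in> M \<and> z \<notin> S \<and> y \<noteq> z" if "(y, z) \<in> Q" for y z
      using that by (auto simp: Q_def)
    have Q_asym: "(z, y) \<notin> Q" if "(y, z) \<in> Q" for y z
      using QD[OF that] QD[of z y] by blast
    have finQ: "finite Q"
      unfolding Q_def using S L by auto
    have "(\<Sum>S'\<in>?P. of_bool (S = S') * ?g \<omega> S') = ?g \<omega> S"
      using S fin by (intro sum_of_bool_eq) auto
    also have "\<dots> = (\<Sum>y\<in>S \<inter> cl S \<omega> x. \<Sum>z\<in>M - S. pair_rate J y z)"
      using S L by (intro sum.mono_neutral_cong_right) (auto simp: out_rate_def)
    also have "\<dots> = (\<Sum>(y, z)\<in>Q. pair_rate J y z)"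
      unfolding Q_def by (rule sum.cartesian_product)
    also have "\<dots> = (\<Sum>q\<in>Q. \<Sum>e\<in>links (fst q) (snd q). J e)"
      by (intro sum.cong) (auto simp: pair_rate_def links_def dest: QD)
    also have "\<dots> = (\<Sum>e\<in>(\<Union>q\<in>Q. links (fst q) (snd q)). J e)"
      using finQ
      by (subst sum.UNION_disjoint) (auto simp: links_def doubleton_eq_iff Q_asym)
    also have "\<dots> = (\<Sum>e\<in>(\<Union>q\<in>Q. links (fst q) (snd q)). J e * (F (insert e \<omega>) - F \<omega>))"
    proof (rule sum.cong[OF refl])
      fix e assume "e \<in> (\<Union>q\<in>Q. links (fst q) (snd q))"
      then obtain y z where q: "(y, z) \<in> Q" and e: "e \<in> links y z" by auto
      let ?\<omega> = "insert e \<omega>"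
      have "y \<in> cl M ?\<omega> x"
        using QD[OF q] cl_mono[of S M \<omega> ?\<omega> x] S L by blast
      moreover have "(y, z) \<in> open_step M (\<lambda>e. e \<in> ?\<omega>)"
        unfolding open_step_iff using QD[OF q] S L e by auto
      ultimately have z: "z \<in> cl M ?\<omega> x"
        by (rule cl_step)
      have "\<not> cl M ?\<omega> z \<subseteq> L"
      proof (cases "z \<in> L")
        case True
        then have "\<not> cl M \<omega> z \<subseteq> L"
          using QD[OF q] by (auto simp: S_def trapped_def)
        then show ?thesis using cl_mono[of M M \<omega> ?\<omega> z] by blast
      next
        case False
        then show ?thesis using cl_refl by fast
      qed
      then have "F ?\<omega> = 1"
        using cl_trans[OF z] by (auto simp: F_def)
      then show "J e = J e * (F ?\<omega> - F \<omega>)"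
        using True by (simp add: F_def)
    qed
    also have "\<dots> \<le> (\<Sum>e\<in>bonds M. J e * (F (insert e \<omega>) - F \<omega>))"
    proof (rule sum_mono2[OF fin(3)])
      show "(\<Union>q\<in>Q. links (fst q) (snd q)) \<subseteq> bonds M"
      proof (rule UN_least)
        fix q assume "q \<in> Q"
        then have "fst q \<in> S \<and> snd q \<in> M \<and> fst q \<noteq> snd q"
          using QD[of "fst q" "snd q"] by simp
        then show "links (fst q) (snd q) \<subseteq> bonds M"
          using S L by (intro links_subset_bonds) auto
      qed
    qed (use F_mono J_nonneg[OF L(3)] in auto)
    finally show ?thesis by (simp add: S_def)
  qed
  have factor: "?E (\<lambda>\<omega>. of_bool (trapped L M \<omega> = S) * ?g \<omega> S)
      = ?E (\<lambda>\<omega>. of_bool (trapped L M \<omega> = S)) * flux M J \<beta> S x" if S: "S \<subseteq> L" for S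
  proof -
    have dep1: "depends_on (bonds M - bonds S) (\<lambda>\<omega>. of_bool (trapped L M \<omega> = S) :: real)"
      by (rule depends_on_compose[OF depends_on_trapped_eq[OF L(2)]])
    have dep2: "depends_on (bonds S) (\<lambda>\<omega>. ?g \<omega> S)"
      by (rule depends_on_compose[OF depends_on_cl])
    have "?E (\<lambda>\<omega>. ?g \<omega> S) = bexp (bonds S) (open_prob J \<beta>) (\<lambda>\<omega>. ?g \<omega> S)"
      using bexp_restrict[OF fin(3) dep2] bonds_mono[of S M] S L(2)
      by (simp add: Int_absorb1)
    also have "\<dots> = flux M J \<beta> S x"
      by (simp only: bexp_sum flux_def mult.commute[of _ "out_rate J _ _"] bexp_cmult)
    finally show ?thesis
      using bexp_indep[OF fin(3) dep1 dep2] by (simp add: Diff_Int_distrib2)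
  qed
  have "(1 - F \<omega>) = (\<Sum>S\<in>?P. of_bool (trapped L M \<omega> = S) * 1)" for \<omega>
  proof (cases "cl M \<omega> x \<subseteq> L")
    case True
    then show ?thesis
      using fin L by (subst sum_of_bool_eq) (auto simp: F_def trapped_def)
  next
    case False
    then have "x \<notin> trapped L M \<omega>" by (simp add: trapped_def)
    then have "(\<Sum>S\<in>?P. of_bool (trapped L M \<omega> = S) * 1) = (0 :: real)"
      by (intro sum.neutral) auto
    moreover have "F \<omega> = 1" using False by (simp add: F_def)
    ultimately show ?thesis by simp
  qed
  then have "?E (\<lambda>\<omega>. 1 - F \<omega>) = (\<Sum>S\<in>?P. ?E (\<lambda>\<omega>. of_bool (trapped L M \<omega> = S)))"
    by (simp add: bexp_sum)
  then have "c * (1 - ?E F) = (\<Sum>S\<in>?P. ?E (\<lambda>\<omega>. of_bool (trapped L M \<omega> = S)) * c)"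
    using fin by (simp add: bexp_diff bexp_const sum_distrib_left mult.commute)
  also have "\<dots> \<le> (\<Sum>S\<in>?P. ?E (\<lambda>\<omega>. of_bool (trapped L M \<omega> = S)) * flux M J \<beta> S x)"
    by (intro sum_mono mult_left_mono c bexp_nonneg[OF prob_bounds[OF L(3) \<beta>]]) auto
  also have "\<dots> = ?E (\<lambda>\<omega>. \<Sum>S\<in>?P. of_bool (trapped L M \<omega> = S) * ?g \<omega> S)"
    unfolding bexp_sum by (intro sum.cong) (auto simp: factor)
  also have "\<dots> \<le> ?E (\<lambda>\<omega>. \<Sum>e\<in>bonds M. J e * (F (insert e \<omega>) - F \<omega>))"
    by (rule bexp_mono[OF prob_bounds[OF L(3) \<beta>] pointwise])
  finally show ?thesis
    by (simp only: bexp_sum bexp_cmult)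
qed

lemma flux_mono:
  assumes "finite S" "S \<subseteq> V" "U \<subseteq> V" "0 \<le> \<beta>" "\<beta> \<le> \<beta>'"
  shows "flux U J \<beta> S x \<le> flux U J \<beta>' S x"
  unfolding flux_def
proof (intro sum_mono mult_right_mono)
  fix y assume y: "y \<in> S"
  show "bexp (bonds S) (open_prob J \<beta>) (\<lambda>\<omega>. of_bool (y \<in> cl S \<omega> x))
      \<le> bexp (bonds S) (open_prob J \<beta>') (\<lambda>\<omega>. of_bool (y \<in> cl S \<omega> x))"
    using assms cl_mono[OF order_refl, of _ _ S x]
    by (intro bexp_open_prob_mono finite_bonds J_nonneg) (auto, blast)
  show "0 \<le> out_rate J y (U - S)"
    using y assms by (intro out_rate_nonneg) auto
qed

text \<open>Integration of \<open>f' \<ge> c * (1 - f)\<close>; for \<open>\<beta> \<ge> \<beta>0\<close> the flux is at least its value at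
  \<open>\<beta>0\<close>.\<close>
lemma escape_prob_ge:
  assumes L: "x \<in> L" "L \<subseteq> M" "M \<subseteq> V" "finite M" and \<beta>: "0 \<le> \<beta>0" "\<beta>0 \<le> \<beta>1"
    and c: "\<And>S. S \<subseteq> L \<Longrightarrow> x \<in> S \<Longrightarrow> c \<le> flux M J \<beta>0 S x"
  shows "1 - exp (- c * (\<beta>1 - \<beta>0))
    \<le> bexp (bonds M) (open_prob J \<beta>1) (\<lambda>\<omega>. of_bool (\<not> cl M \<omega> x \<subseteq> L))"
proof -
  let ?F = "\<lambda>\<omega>. of_bool (\<not> cl M \<omega> x \<subseteq> L) :: real"
  let ?f = "\<lambda>\<beta>. bexp (bonds M) (open_prob J \<beta>) ?F"
  \<comment> \<open>The integrating factor of \<open>f' \<ge> c * (1 - f)\<close> makes this function nonincreasing.\<close>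
  let ?g = "\<lambda>\<beta>. (1 - ?f \<beta>) * exp (c * \<beta>)"
  have "?g \<beta>1 \<le> ?g \<beta>0"
  proof (rule DERIV_nonpos_imp_nonincreasing[OF \<beta>(2)])
    fix b assume b: "\<beta>0 \<le> b" "b \<le> \<beta>1"
    let ?D = "\<Sum>e\<in>bonds M. J e * bexp (bonds M) (open_prob J b) (\<lambda>\<omega>. ?F (insert e \<omega>) - ?F \<omega>)"
    have b0: "0 \<le> b" using b \<beta> by simp
    have "c \<le> flux M J b S x" if "S \<subseteq> L" "x \<in> S" for S
      using c[OF that] flux_mono[of S M \<beta>0 b x] that L b \<beta> finite_subset[of S M] by force
    then have "c * (1 - ?f b) \<le> ?D"
      by (rule escape_influence[OF L b0])
    then have "(c * (1 - ?f b) - ?D) * exp (c * b) \<le> 0"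
      by (simp add: mult_le_0_iff)
    moreover have "(?g has_real_derivative (c * (1 - ?f b) - ?D) * exp (c * b)) (at b)"
      by (rule derivative_eq_intros russo[OF finite_bonds[OF L(4)]] refl)+
        (simp add: algebra_simps)
    ultimately show "\<exists>y. (?g has_real_derivative y) (at b) \<and> y \<le> 0"
      by blast
  qed
  also have "\<dots> \<le> 1 * exp (c * \<beta>0)"
    using \<beta> by (intro mult_right_mono) (simp_all add: bexp_nonneg[OF prob_bounds[OF L(3)]])
  finally have "1 - ?f \<beta>1 \<le> exp (c * \<beta>0) / exp (c * \<beta>1)"
    by (simp add: field_simps)
  also have "\<dots> = exp (- c * (\<beta>1 - \<beta>0))"
    by (simp add: exp_diff[symmetric] algebra_simps)
  finally show ?thesis by simp
qed

lemma out_rate_split: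
  assumes "y \<in> V" "A \<inter> B = {}" "A \<union> B \<subseteq> V"
  shows "out_rate J y (A \<union> B) = out_rate J y A + out_rate J y B"
  unfolding out_rate_def using assms
  by (intro infsum_Un_disjoint summable_on_subset_banach[OF summable]) auto

text \<open>The set \<open>M\<close> works for all \<open>S \<subseteq> L\<close> at once, because the flux lost is at most the total rate from
  \<open>L\<close> to the complement of \<open>M\<close>.\<close>
lemma flux_truncate:
  assumes L: "L \<subseteq> V" "finite L" and \<beta>: "0 \<le> \<beta>" and \<epsilon>: "0 < \<epsilon>"
  obtains M where "L \<subseteq> M" "M \<subseteq> V" "finite M"
    "\<And>S. S \<subseteq> L \<Longrightarrow> flux V J \<beta> S x - \<epsilon> \<le> flux M J \<beta> S x"
proof -
  define \<delta> where "\<delta> = \<epsilon> / (real (card L) + 1)"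
  have \<delta>: "0 < \<delta>" using \<epsilon> by (simp add: \<delta>_def)
  have "\<forall>\<^sub>F M in finite_subsets_at_top V. \<forall>y\<in>L. out_rate J y V - \<delta> < sum (pair_rate J y) M"
  proof (rule eventually_ball_finite[OF L(2)], rule ballI)
    fix y assume "y \<in> L"
    then have "(sum (pair_rate J y) \<longlongrightarrow> out_rate J y V) (finite_subsets_at_top V)"
      unfolding out_rate_def using L by (intro infsum_tendsto summable) auto
    then show "\<forall>\<^sub>F M in finite_subsets_at_top V. out_rate J y V - \<delta> < sum (pair_rate J y) M"
      by (rule order_tendstoD) (use \<delta> in simp)
  qed
  then obtain X where X: "finite X" "X \<subseteq> V"
    "\<And>M. finite M \<Longrightarrow> X \<subseteq> M \<Longrightarrow> M \<subseteq> V \<Longrightarrow> \<forall>y\<in>L. out_rate J y V - \<delta> < sum (pair_rate J y) M"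
    unfolding eventually_finite_subsets_at_top by metis
  define M where "M = X \<union> L"
  have M: "L \<subseteq> M" "M \<subseteq> V" "finite M" using X L by (auto simp: M_def)
  have tail: "out_rate J y (V - M) \<le> \<delta>" if "y \<in> L" for y
  proof -
    have "out_rate J y V = out_rate J y M + out_rate J y (V - M)"
      using out_rate_split[of y M "V - M"] M L that by (auto simp: Un_absorb1)
    moreover have "out_rate J y M = sum (pair_rate J y) M"
      using M by (simp add: out_rate_def)
    ultimately show ?thesis
      using X(3)[of M] M that by (fastforce simp: M_def)
  qed
  have "flux V J \<beta> S x - \<epsilon> \<le> flux M J \<beta> S x" if S: "S \<subseteq> L" for S
  proof -
    let ?p = "\<lambda>y. bexp (bonds S) (open_prob J \<beta>) (\<lambda>\<omega>. of_bool (y \<in> cl S \<omega> x))"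
    have SV: "S \<subseteq> V" "finite S" using S L finite_subset by auto
    have p: "0 \<le> ?p y" "?p y \<le> 1" for y
    proof -
      show "0 \<le> ?p y" by (rule bexp_nonneg[OF prob_bounds[OF SV(1) \<beta>]]) auto
      have "?p y \<le> bexp (bonds S) (open_prob J \<beta>) (\<lambda>_. 1)"
        by (rule bexp_mono[OF prob_bounds[OF SV(1) \<beta>]]) auto
      then show "?p y \<le> 1" using SV by (simp add: bexp_const finite_bonds)
    qed
    have "flux V J \<beta> S x = (\<Sum>y\<in>S. ?p y * out_rate J y (M - S) + ?p y * out_rate J y (V - M))"
      unfolding flux_def distrib_left[symmetric]
    proof (intro sum.cong refl arg_cong2[where f = times])
      fix y assume "y \<in> S"
      moreover have "V - S = (M - S) \<union> (V - M)" using M S by auto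
      ultimately show "out_rate J y (V - S) = out_rate J y (M - S) + out_rate J y (V - M)"
        using out_rate_split[of y "M - S" "V - M"] SV M by auto
    qed
    also have "\<dots> = flux M J \<beta> S x + (\<Sum>y\<in>S. ?p y * out_rate J y (V - M))"
      by (simp add: flux_def sum.distrib)
    also have "(\<Sum>y\<in>S. ?p y * out_rate J y (V - M)) \<le> (\<Sum>y\<in>S. 1 * \<delta>)"
      using S SV M by (intro sum_mono mult_mono p tail out_rate_nonneg) auto
    also have "(\<Sum>y\<in>S. 1 * \<delta>) \<le> real (card L) * \<delta>"
      using card_mono[OF L(2) S] \<delta> by simp
    also have "\<dots> \<le> \<epsilon>"
      using \<epsilon> by (simp add: \<delta>_def field_simps)
    finally show ?thesis by simp
  qed
  with M show ?thesis by (rule that)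
qed

end


section \<open>Invariance under automorphisms\<close>

definition bond_map :: "('v \<Rightarrow> 'v) \<Rightarrow> 'v bond \<Rightarrow> 'v bond" where
  "bond_map \<gamma> e = (case e of Unoriented s \<Rightarrow> Unoriented (\<gamma> ` s) | Oriented x y \<Rightarrow> Oriented (\<gamma> x) (\<gamma> y))"

lemma bond_map_simps [simp]:
  "bond_map \<gamma> (Unoriented s) = Unoriented (\<gamma> ` s)"
  "bond_map \<gamma> (Oriented x y) = Oriented (\<gamma> x) (\<gamma> y)"
  by (simp_all add: bond_map_def)

lemma inj_on_bond_map:
  assumes "inj_on \<gamma> S"
  shows "inj_on (bond_map \<gamma>) (bonds S)"
proof (rule inj_onI)
  fix e e' assume e: "e \<in> bonds S" "e' \<in> bonds S" "bond_map \<gamma> e = bond_map \<gamma> e'"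
  have ends: "s \<subseteq> S" if "Unoriented s \<in> bonds S" for s
    using that by (auto simp: bonds_def)
  show "e = e'"
  proof (cases e)
    case (Unoriented s)
    then obtain s' where s': "e' = Unoriented s'" "\<gamma> ` s = \<gamma> ` s'"
      using e(3) by (cases e') auto
    then show ?thesis
      using Unoriented e ends inj_on_image_eq_iff[OF assms] by auto
  next
    case (Oriented u v)
    then obtain u' v' where "e' = Oriented u' v'" "\<gamma> u = \<gamma> u'" "\<gamma> v = \<gamma> v'"
      using e(3) by (cases e') auto
    then show ?thesis
      using Oriented e inj_onD[OF assms] by (auto simp: bonds_def)
  qed
qed

lemma bonds_image:
  assumes "inj_on \<gamma> S"
  shows "bonds (\<gamma> ` S) = bond_map \<gamma> ` bonds S"
proof
  show "bonds (\<gamma> ` S) \<subseteq> bond_map \<gamma> ` bonds S"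
  proof
    fix e assume "e \<in> bonds (\<gamma> ` S)"
    then obtain u v where uv: "u \<in> S" "v \<in> S" "\<gamma> u \<noteq> \<gamma> v"
      and e: "e = Unoriented {\<gamma> u, \<gamma> v} \<or> e = Oriented (\<gamma> u) (\<gamma> v)"
      unfolding bonds_def by auto
    have "links u v \<subseteq> bonds S"
      using uv by (intro links_subset_bonds) auto
    moreover have "e \<in> bond_map \<gamma> ` links u v"
      using e by (auto simp: links_def)
    ultimately show "e \<in> bond_map \<gamma> ` bonds S" by blast
  qed
  show "bond_map \<gamma> ` bonds S \<subseteq> bonds (\<gamma> ` S)"
  proof
    fix e assume "e \<in> bond_map \<gamma> ` bonds S"
    then obtain u v where uv: "u \<in> S" "v \<in> S" "u \<noteq> v"
      and e: "e = Unoriented {\<gamma> u, \<gamma> v} \<or> e = Oriented (\<gamma> u) (\<gamma> v)"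
      unfolding bonds_def by auto
    have "links (\<gamma> u) (\<gamma> v) \<subseteq> bonds (\<gamma> ` S)"
      using uv assms by (intro links_subset_bonds) (auto dest: inj_onD)
    then show "e \<in> bonds (\<gamma> ` S)"
      using e by (auto simp: links_def)
  qed
qed

lemma cl_image:
  assumes inj: "inj_on \<gamma> S" and x: "x \<in> S" and \<omega>: "\<omega> \<subseteq> bonds S"
  shows "cl (\<gamma> ` S) (bond_map \<gamma> ` \<omega>) (\<gamma> x) = \<gamma> ` cl S \<omega> x"
proof -
  let ?R = "open_step S (\<lambda>e. e \<in> \<omega>)" and ?R' = "open_step (\<gamma> ` S) (\<lambda>e. e \<in> bond_map \<gamma> ` \<omega>)"
  have step_iff: "(\<gamma> u, \<gamma> v) \<in> ?R' \<longleftrightarrow> (u, v) \<in> ?R" if uv: "u \<in> S" "v \<in> S" for u v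
  proof (cases "u = v")
    case False
    have mem: "bond_map \<gamma> e \<in> bond_map \<gamma> ` \<omega> \<longleftrightarrow> e \<in> \<omega>" if "e \<in> links u v" for e
      using inj_on_image_mem_iff[OF inj_on_bond_map[OF inj] _ \<omega>, of e]
        links_subset_bonds[OF uv False] that by blast
    have "\<gamma> u \<noteq> \<gamma> v" using uv False inj by (auto dest: inj_onD)
    with uv False mem[of "Unoriented {u, v}"] mem[of "Oriented u v"]
    show ?thesis by (simp add: open_step_def links_def)
  qed (simp add: open_step_def)
  have sub: "?R \<subseteq> S \<times> S" "?R' \<subseteq> \<gamma> ` S \<times> \<gamma> ` S"
    by (auto simp: open_step_def)
  have "(\<gamma> x, \<gamma> y) \<in> ?R'\<^sup>*" if "(x, y) \<in> ?R\<^sup>*" for y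
    using that
  proof (induction rule: rtrancl_induct)
    case (step u v)
    then have "(\<gamma> u, \<gamma> v) \<in> ?R'"
      using sub(1) step_iff by blast
    with step.IH show ?case by (rule rtrancl_into_rtrancl)
  qed simp
  moreover have "\<exists>y\<in>S. w = \<gamma> y \<and> (x, y) \<in> ?R\<^sup>*" if "(\<gamma> x, w) \<in> ?R'\<^sup>*" for w
    using that
  proof (induction rule: rtrancl_induct)
    case base
    then show ?case using x by blast
  next
    case (step u v)
    then obtain u0 v0 where "u0 \<in> S" "v0 \<in> S" "u = \<gamma> u0" "v = \<gamma> v0" "(x, u0) \<in> ?R\<^sup>*"
      using sub(2) by blast
    moreover from this have "(u0, v0) \<in> ?R"
      using step.hyps(2) step_iff by blast
    ultimately show ?case by (blast intro: rtrancl_into_rtrancl)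
  qed
  ultimately show ?thesis
    unfolding cluster_def by blast
qed

lemma flux_image:
  assumes aut: "\<gamma> \<in> graph_aut V E" and J: "aut_invariant V E J"
    and S: "S \<subseteq> V" "x \<in> S"
  shows "flux V J \<beta> (\<gamma> ` S) (\<gamma> x) = flux V J \<beta> S x"
proof -
  have bij: "bij_betw \<gamma> V V" using aut by (simp add: graph_aut_def)
  then have injV: "inj_on \<gamma> V" by (rule bij_betw_imp_inj_on)
  then have inj: "inj_on \<gamma> S" using S(1) by (rule inj_on_subset)
  have J_inv: "J (bond_map \<gamma> e) = J e" if "e \<in> bonds V" for e
    using that aut J unfolding bonds_def aut_invariant_def by auto
  have rate: "out_rate J (\<gamma> y) (V - \<gamma> ` S) = out_rate J y (V - S)" if y: "y \<in> S" for y
  proof -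
    have "V - \<gamma> ` S = \<gamma> ` (V - S)"
      using bij S injV by (auto simp: bij_betw_def inj_on_image_set_diff[OF injV])
    then have "bij_betw \<gamma> (V - S) (V - \<gamma> ` S)"
      using inj_on_subset[OF injV] by (simp add: bij_betw_def)
    then have "out_rate J (\<gamma> y) (V - \<gamma> ` S) = (\<Sum>\<^sub>\<infinity>z\<in>V - S. pair_rate J (\<gamma> y) (\<gamma> z))"
      unfolding out_rate_def by (rule infsum_reindex_bij_betw[symmetric])
    also have "\<dots> = out_rate J y (V - S)"
      unfolding out_rate_def
    proof (rule infsum_cong)
      fix z assume z: "z \<in> V - S"
      then have "links y z \<subseteq> bonds V"
        using y S by (intro links_subset_bonds) auto
      then have "J (Unoriented {\<gamma> y, \<gamma> z}) = J (Unoriented {y, z})"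
        "J (Oriented (\<gamma> y) (\<gamma> z)) = J (Oriented y z)"
        using J_inv[of "Unoriented {y, z}"] J_inv[of "Oriented y z"] by (auto simp: links_def)
      moreover have "\<gamma> y \<noteq> \<gamma> z" "y \<noteq> z"
        using y z S injV by (auto dest: inj_onD)
      ultimately show "pair_rate J (\<gamma> y) (\<gamma> z) = pair_rate J y z"
        by (simp add: pair_rate_def)
    qed
    finally show ?thesis .
  qed
  have prob: "bexp (bonds (\<gamma> ` S)) (open_prob J \<beta>) (\<lambda>\<omega>. of_bool (\<gamma> y \<in> cl (\<gamma> ` S) \<omega> (\<gamma> x)))
      = bexp (bonds S) (open_prob J \<beta>) (\<lambda>\<omega>. of_bool (y \<in> cl S \<omega> x))" if y: "y \<in> S" for y
  proof -
    have "bexp (bonds (\<gamma> ` S)) (open_prob J \<beta>) (\<lambda>\<omega>. of_bool (\<gamma> y \<in> cl (\<gamma> ` S) \<omega> (\<gamma> x)))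
        = bexp (bonds S) (open_prob J \<beta> \<circ> bond_map \<gamma>)
            (\<lambda>\<omega>. of_bool (\<gamma> y \<in> cl (\<gamma> ` S) (bond_map \<gamma> ` \<omega>) (\<gamma> x)))"
      unfolding bonds_image[OF inj] by (rule bexp_reindex[OF inj_on_bond_map[OF inj]])
    also have "\<dots> = bexp (bonds S) (open_prob J \<beta>)
            (\<lambda>\<omega>. of_bool (\<gamma> y \<in> cl (\<gamma> ` S) (bond_map \<gamma> ` \<omega>) (\<gamma> x)))"
      using J_inv bonds_mono[OF S(1)]
      by (intro bexp_cong_prob) (auto simp: open_prob_def)
    also have "\<dots> = bexp (bonds S) (open_prob J \<beta>) (\<lambda>\<omega>. of_bool (y \<in> cl S \<omega> x))"
      using cluster_subset[OF S(2)] y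
      by (intro bexp_cong arg_cong[where f = of_bool])
        (simp add: cl_image[OF inj S(2)] inj_on_image_mem_iff[OF inj])
    finally show ?thesis .
  qed
  show ?thesis
    unfolding flux_def sum.reindex[OF inj] comp_def
    by (intro sum.cong refl arg_cong2[where f = times] rate prob)
qed

text \<open>Sets chosen for one vertex of each of the finitely many orbits are transported to all other
  vertices by automorphisms.\<close>
lemma uniform_flux_bound:
  assumes qt: "quasi_transitive V E" and J: "aut_invariant V E J"
    and flux: "\<And>x. x \<in> V \<Longrightarrow> \<exists>S. finite S \<and> S \<subseteq> V \<and> x \<in> S \<and> \<beta> * flux V J \<beta> S x < 1"
  obtains N d where "0 < d" "\<And>x. x \<in> V \<Longrightarrow>
    \<exists>S. finite S \<and> S \<subseteq> V \<and> x \<in> S \<and> card S \<le> N \<and> \<beta> * flux V J \<beta> S x \<le> 1 - d"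
proof -
  obtain R where R: "R \<subseteq> V" "finite R" "aut_orbit V E ` V = aut_orbit V E ` R"
    using finite_subset_image[of "aut_orbit V E ` V" "aut_orbit V E" V] qt
    by (auto simp: quasi_transitive_def)
  have "\<forall>x\<in>V. \<exists>S. finite S \<and> S \<subseteq> V \<and> x \<in> S \<and> \<beta> * flux V J \<beta> S x < 1"
    using flux by blast
  then obtain T where T: "\<And>x. x \<in> V \<Longrightarrow> finite (T x) \<and> T x \<subseteq> V \<and> x \<in> T x \<and> \<beta> * flux V J \<beta> (T x) x < 1"
    by metis
  define d where "d = Min (insert 1 ((\<lambda>r. 1 - \<beta> * flux V J \<beta> (T r) r) ` R))"
  define N where "N = (\<Sum>r\<in>R. card (T r))"
  show ?thesis
  proof (rule that[of d N])
    show "0 < d"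
      unfolding d_def using R T by (subst Min_gr_iff) auto
    fix x assume x: "x \<in> V"
    have "id \<in> graph_aut V E"
      by (auto simp: graph_aut_def)
    then have "x \<in> aut_orbit V E x"
      unfolding aut_orbit_def by (auto intro!: exI[of _ id])
    moreover obtain r where r: "r \<in> R" "aut_orbit V E x = aut_orbit V E r"
      using R(3) x by blast
    ultimately obtain \<gamma> where \<gamma>: "\<gamma> \<in> graph_aut V E" "x = \<gamma> r"
      by (auto simp: aut_orbit_def)
    have rV: "r \<in> V" using r R by blast
    note Tr = T[OF rV]
    have bij: "bij_betw \<gamma> V V" using \<gamma> by (simp add: graph_aut_def)
    have "flux V J \<beta> (\<gamma> ` T r) x = flux V J \<beta> (T r) r"
      unfolding \<gamma>(2) using Tr by (intro flux_image[OF \<gamma>(1) J]) auto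
    moreover have "d \<le> 1 - \<beta> * flux V J \<beta> (T r) r"
      unfolding d_def using R r by (intro Min_le) auto
    moreover have "card (\<gamma> ` T r) \<le> N"
      using Tr r R member_le_sum[of r R "\<lambda>r. card (T r)"] card_image_le[of "T r" \<gamma>]
      unfolding N_def by fastforce
    moreover have "\<gamma> ` T r \<subseteq> V" "x \<in> \<gamma> ` T r" "finite (\<gamma> ` T r)"
      using Tr \<gamma>(2) bij by (auto simp: bij_betw_def)
    ultimately show "\<exists>S. finite S \<and> S \<subseteq> V \<and> x \<in> S \<and> card S \<le> N \<and> \<beta> * flux V J \<beta> S x \<le> 1 - d"
      by (intro exI[of _ "\<gamma> ` T r"]) auto
  qed
qed


section \<open>From finite volumes to the infinite model\<close>

lemma cluster_eq_cl: "cluster L \<omega> x = cl L {e \<in> bonds L. \<omega> e} x"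
proof -
  have "open_step L \<omega> = open_step L (\<lambda>e. e \<in> {e \<in> bonds L. \<omega> e})"
    using links_subset_bonds[of _ L] by (fastforce simp: open_step_def links_def)
  then show ?thesis by (simp add: cluster_def)
qed

lemma cluster_mono: "L \<subseteq> M \<Longrightarrow> cluster L \<omega> x \<subseteq> cluster M \<omega> x"
  unfolding cluster_eq_Image by (intro Image_mono rtrancl_mono) (auto simp: open_step_def)

lemma cluster_UN:
  assumes L: "incseq L" "(\<Union>n. L n) = V"
  shows "(\<Union>n. cluster (L n) \<omega> x) = cluster V \<omega> x"
proof
  show "(\<Union>n. cluster (L n) \<omega> x) \<subseteq> cluster V \<omega> x"
    using L cluster_mono[of "L _" V] by blast
  show "cluster V \<omega> x \<subseteq> (\<Union>n. cluster (L n) \<omega> x)"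
  proof
    fix y assume "y \<in> cluster V \<omega> x"
    then have "(x, y) \<in> (open_step V \<omega>)\<^sup>*" by (simp add: cluster_def)
    then show "y \<in> (\<Union>n. cluster (L n) \<omega> x)"
    proof (induction rule: rtrancl_induct)
      case base
      then show ?case by (auto simp: cluster_def)
    next
      case (step u v)
      obtain n where n: "(x, u) \<in> (open_step (L n) \<omega>)\<^sup>*"
        using step.IH by (auto simp: cluster_def)
      obtain i j where ij: "u \<in> L i" "v \<in> L j"
        using step.hyps(2) L(2) by (auto simp: open_step_def)
      define k where "k = max n (max i j)"
      have "L n \<subseteq> L k" "L i \<subseteq> L k" "L j \<subseteq> L k"
        by (rule incseqD[OF L(1)], simp add: k_def)+
      then have "(u, v) \<in> open_step (L k) \<omega>" "u \<in> cluster (L k) \<omega> x"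
        using step.hyps(2) ij n cluster_mono[of "L n" "L k" \<omega> x]
        by (auto simp: open_step_def cluster_def)
      then show ?case
        by (auto simp: cluster_def intro: rtrancl_into_rtrancl)
    qed
  qed
qed

lemma exhaustion:
  fixes V :: "'v set"
  assumes "countable V" "finite F" "F \<subseteq> V"
  obtains L where "incseq L" "(\<Union>n. L n) = V" "\<And>n. finite (L n)" "\<And>n. F \<subseteq> L n"
proof (cases "V = {}")
  case True
  then show ?thesis using assms by (intro that[of "\<lambda>_. {}"]) (auto simp: incseq_def)
next
  case False
  let ?L = "\<lambda>n. F \<union> from_nat_into V ` {..<n}"
  have r: "range (from_nat_into V) = V"
    by (rule range_from_nat_into[OF False assms(1)])
  have "(\<Union>n. ?L n) = V"
  proof
    show "V \<subseteq> (\<Union>n. ?L n)"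
    proof
      fix v assume "v \<in> V"
      then obtain k where "v = from_nat_into V k" using r by blast
      then have "v \<in> ?L (Suc k)" by auto
      then show "v \<in> (\<Union>n. ?L n)" by blast
    qed
    show "(\<Union>n. ?L n) \<subseteq> V" using assms(3) r by blast
  qed
  moreover have "incseq ?L"
    by (intro monoI Un_mono image_mono) auto
  ultimately show ?thesis using assms(2) by (intro that[of ?L]) auto
qed

context percolation
begin

lemma measurable_open_set:
  assumes "finite B" "B \<subseteq> bonds V"
  shows "(\<lambda>\<omega>. {e \<in> B. \<omega> e}) \<in> perc V J \<beta> \<rightarrow>\<^sub>M count_space (Pow B)"
proof -
  have coord: "Measurable.pred (perc V J \<beta>) (\<lambda>\<omega>. \<omega> e)" if "e \<in> B" for e
  proof -
    have "(\<lambda>\<omega>. \<omega> e) \<in> perc V J \<beta> \<rightarrow>\<^sub>M measure_pmf (bernoulli_pmf (1 - exp (- \<beta> * J e)))"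
      unfolding perc_def using that assms by (intro measurable_component_singleton) auto
    then show ?thesis by simp
  qed
  have "(\<lambda>\<omega>. {e \<in> B. \<omega> e}) -` {s} \<inter> space (perc V J \<beta>) \<in> sets (perc V J \<beta>)" if "s \<subseteq> B" for s
  proof -
    have "(\<lambda>\<omega>. {e \<in> B. \<omega> e}) -` {s} \<inter> space (perc V J \<beta>)
        = {\<omega> \<in> space (perc V J \<beta>). \<forall>e\<in>B. \<omega> e = (e \<in> s)}"
      using that by auto
    also have "\<dots> \<in> sets (perc V J \<beta>)"
      using assms coord by measurable
    finally show ?thesis .
  qed
  then show ?thesis
    using assms(1) by (subst measurable_count_space_eq2) auto
qed

lemma emeasure_open_set:
  assumes "finite B" "B \<subseteq> bonds V" "0 \<le> \<beta>" "s \<subseteq> B"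
  shows "emeasure (perc V J \<beta>) {\<omega> \<in> space (perc V J \<beta>). {e \<in> B. \<omega> e} = s}
    = ennreal ((\<Prod>e\<in>s. open_prob J \<beta> e) * (\<Prod>e\<in>B - s. 1 - open_prob J \<beta> e))"
proof -
  let ?p = "open_prob J \<beta>"
  let ?N = "\<lambda>e. measure_pmf (bernoulli_pmf (?p e))"
  have perc: "perc V J \<beta> = Pi\<^sub>M (bonds V) ?N"
    by (simp add: perc_def open_prob_def)
  have p: "0 \<le> ?p e \<and> ?p e \<le> 1" if "e \<in> B" for e
    using assms that by (intro prob_bounds[OF order_refl]) auto
  have "{\<omega> \<in> space (perc V J \<beta>). {e \<in> B. \<omega> e} = s}
      = prod_emb (bonds V) ?N B (Pi\<^sub>E B (\<lambda>e. {e \<in> s}))"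
    unfolding perc prod_emb_def
    using assms(2,4) by (fastforce simp: space_PiM restrict_PiE_iff Pi_iff)
  then have "emeasure (perc V J \<beta>) {\<omega> \<in> space (perc V J \<beta>). {e \<in> B. \<omega> e} = s}
      = (\<Prod>e\<in>B. emeasure (?N e) {e \<in> s})"
    unfolding perc using assms
    by (simp only:) (intro emeasure_PiM_emb, auto intro: measure_pmf.prob_space_axioms)
  also have "\<dots> = (\<Prod>e\<in>B. ennreal (if e \<in> s then ?p e else 1 - ?p e))"
    using p by (intro prod.cong) (auto simp: emeasure_pmf_single)
  also have "\<dots> = ennreal (\<Prod>e\<in>B. if e \<in> s then ?p e else 1 - ?p e)"
    using p by (intro prod_ennreal) auto
  also have "(\<Prod>e\<in>B. if e \<in> s then ?p e else 1 - ?p e) = (\<Prod>e\<in>s. ?p e) * (\<Prod>e\<in>B - s. 1 - ?p e)"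
  proof -
    have "B \<inter> {e. e \<in> s} = s" "B \<inter> - {e. e \<in> s} = B - s" using assms(4) by auto
    then show ?thesis using assms(1) by (simp add: prod.If_cases)
  qed
  finally show ?thesis .
qed

lemma nn_integral_perc:
  assumes B: "finite B" "B \<subseteq> bonds V" "0 \<le> \<beta>" and F: "\<And>s. 0 \<le> F s"
  shows "(\<integral>\<^sup>+\<omega>. ennreal (F {e \<in> B. \<omega> e}) \<partial>perc V J \<beta>) = ennreal (bexp B (open_prob J \<beta>) F)"
proof -
  let ?P = "perc V J \<beta>" and ?p = "open_prob J \<beta>"
  let ?X = "\<lambda>s. {\<omega> \<in> space ?P. {e \<in> B. \<omega> e} = s}"
  have X: "?X s \<in> sets ?P" if "s \<in> Pow B" for s
  proof -
    have "?X s = (\<lambda>\<omega>. {e \<in> B. \<omega> e}) -` {s} \<inter> space ?P" by auto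
    then show ?thesis using measurable_sets[OF measurable_open_set[OF B(1,2)], of "{s}"] that by simp
  qed
  have w: "0 \<le> (\<Prod>e\<in>s. ?p e) * (\<Prod>e\<in>B - s. 1 - ?p e)" if "s \<in> Pow B" for s
    using that prob_bounds[OF order_refl B(3)] B(2)
    by (intro mult_nonneg_nonneg prod_nonneg ballI) auto
  have "(\<integral>\<^sup>+\<omega>. ennreal (F {e \<in> B. \<omega> e}) \<partial>?P) = (\<integral>\<^sup>+\<omega>. (\<Sum>s\<in>Pow B. ennreal (F s) * indicator (?X s) \<omega>) \<partial>?P)"
  proof (rule nn_integral_cong)
    fix \<omega> assume \<omega>: "\<omega> \<in> space ?P"
    have "(\<Sum>s\<in>Pow B. ennreal (F s) * indicator (?X s) \<omega>)
        = (\<Sum>s\<in>Pow B. if {e \<in> B. \<omega> e} = s then ennreal (F s) else 0)"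
      using \<omega> by (intro sum.cong) (auto simp: indicator_def)
    also have "\<dots> = ennreal (F {e \<in> B. \<omega> e})"
      using B(1) by auto
    finally show "ennreal (F {e \<in> B. \<omega> e}) = (\<Sum>s\<in>Pow B. ennreal (F s) * indicator (?X s) \<omega>)" ..
  qed
  also have "\<dots> = (\<Sum>s\<in>Pow B. ennreal (F s) * emeasure ?P (?X s))"
    using X by (subst nn_integral_sum) (auto simp: nn_integral_cmult_indicator)
  also have "\<dots> = (\<Sum>s\<in>Pow B. ennreal ((\<Prod>e\<in>s. ?p e) * (\<Prod>e\<in>B - s. 1 - ?p e) * F s))"
  proof (rule sum.cong[OF refl])
    fix s assume s: "s \<in> Pow B"
    then have "emeasure ?P (?X s) = ennreal ((\<Prod>e\<in>s. ?p e) * (\<Prod>e\<in>B - s. 1 - ?p e))"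
      by (intro emeasure_open_set B) auto
    then show "ennreal (F s) * emeasure ?P (?X s)
        = ennreal ((\<Prod>e\<in>s. ?p e) * (\<Prod>e\<in>B - s. 1 - ?p e) * F s)"
      by (simp only: mult.commute[of _ "F s"] ennreal_mult[OF F w[OF s]])
  qed
  also have "\<dots> = ennreal (bexp B ?p F)"
    unfolding bexp_def by (intro sum_ennreal mult_nonneg_nonneg[OF w F])
  finally show ?thesis .
qed

lemma prob_space_perc: "prob_space (perc V J \<beta>)"
  unfolding perc_def by (intro prob_space_PiM measure_pmf.prob_space_axioms)

lemma expected_cluster_size_le:
  assumes V: "countable V" "x \<in> V" and \<beta>: "0 \<le> \<beta>"
    and K: "\<And>L. L \<subseteq> V \<Longrightarrow> finite L \<Longrightarrow> x \<in> L \<Longrightarrow>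
      bexp (bonds L) (open_prob J \<beta>) (\<lambda>\<omega>. real (card (cl L \<omega> x))) \<le> K"
  shows "(\<integral>\<^sup>+\<omega>. cluster_size V \<omega> x \<partial>perc V J \<beta>) \<le> ennreal K"
proof -
  obtain L where L: "incseq L" "(\<Union>n. L n) = V" "\<And>n. finite (L n)" "\<And>n. {x} \<subseteq> L n"
    using exhaustion[OF V(1), of "{x}"] V(2) by auto
  have xL: "x \<in> L n" and LV: "L n \<subseteq> V" for n using L by auto
  let ?F = "\<lambda>n s. real (card (cl (L n) s x))"
  have fin: "finite (cluster (L n) \<omega> x)" for n \<omega>
    by (rule finite_subset[OF cluster_subset[OF xL] L(3)])
  have inc: "incseq (\<lambda>n. cluster (L n) \<omega> x)" for \<omega>
    by (intro monoI cluster_mono monoD[OF L(1)])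
  have eq: "emeasure (count_space UNIV) (cluster (L n) \<omega> x) = ennreal (?F n {e \<in> bonds (L n). \<omega> e})"
    for n \<omega>
  proof -
    have "emeasure (count_space UNIV) (cluster (L n) \<omega> x) = ennreal (real (card (cluster (L n) \<omega> x)))"
      using fin[of n \<omega>] by (simp add: ennreal_of_nat_eq_real_of_nat)
    also have "\<dots> = ennreal (?F n {e \<in> bonds (L n). \<omega> e})"
      by (rule arg_cong[OF cluster_eq_cl, where f = "\<lambda>C. ennreal (real (card C))"])
    finally show ?thesis .
  qed
  have meas: "(\<lambda>\<omega>. emeasure (count_space UNIV) (cluster (L n) \<omega> x)) \<in> borel_measurable (perc V J \<beta>)"
    for n
    unfolding eq
    using measurable_open_set[OF finite_bonds[OF L(3)] bonds_mono[OF LV]]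
    by (rule measurable_compose) simp
  have "cluster_size V \<omega> x = (SUP n. emeasure (count_space UNIV) (cluster (L n) \<omega> x))" for \<omega>
    unfolding cluster_size_def cluster_UN[OF L(1,2), symmetric]
    using inc by (intro SUP_emeasure_incseq[symmetric]) auto
  then have "(\<integral>\<^sup>+\<omega>. cluster_size V \<omega> x \<partial>perc V J \<beta>)
      = (\<integral>\<^sup>+\<omega>. (SUP n. emeasure (count_space UNIV) (cluster (L n) \<omega> x)) \<partial>perc V J \<beta>)"
    by simp
  also have "\<dots> = (SUP n. \<integral>\<^sup>+\<omega>. emeasure (count_space UNIV) (cluster (L n) \<omega> x) \<partial>perc V J \<beta>)"
  proof (rule nn_integral_monotone_convergence_SUP[OF _ meas])
    show "incseq (\<lambda>n \<omega>. emeasure (count_space UNIV) (cluster (L n) \<omega> x))"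
      using inc unfolding incseq_def le_fun_def by (auto intro!: emeasure_mono)
  qed
  also have "\<dots> \<le> ennreal K"
  proof (rule SUP_least)
    fix n
    have "(\<integral>\<^sup>+\<omega>. emeasure (count_space UNIV) (cluster (L n) \<omega> x) \<partial>perc V J \<beta>)
        = ennreal (bexp (bonds (L n)) (open_prob J \<beta>) (?F n))"
      unfolding eq
      by (rule nn_integral_perc[OF finite_bonds[OF L(3)] bonds_mono[OF LV] \<beta>]) simp
    also have "\<dots> \<le> ennreal K"
      by (rule ennreal_leI[OF K[OF LV L(3) xL]])
    finally show "(\<integral>\<^sup>+\<omega>. emeasure (count_space UNIV) (cluster (L n) \<omega> x) \<partial>perc V J \<beta>) \<le> ennreal K" .
  qed
  finally show ?thesis .
qed

lemma prob_infinite_cluster_ge: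
  assumes V: "countable V" "x \<in> V" and F: "finite F" "F \<subseteq> V" and \<beta>: "0 \<le> \<beta>"
    and \<kappa>: "\<And>L. L \<subseteq> V \<Longrightarrow> finite L \<Longrightarrow> F \<subseteq> L \<Longrightarrow> \<exists>M. finite M \<and> M \<subseteq> V \<and>
      \<kappa> \<le> bexp (bonds M) (open_prob J \<beta>) (\<lambda>\<omega>. of_bool (\<not> cl M \<omega> x \<subseteq> L))"
  shows "\<kappa> \<le> \<P>(\<omega> in perc V J \<beta>. cluster_size V \<omega> x = \<infinity>)"
proof -
  let ?P = "perc V J \<beta>"
  interpret prob_space ?P by (rule prob_space_perc)
  obtain L where L: "incseq L" "(\<Union>n. L n) = V" "\<And>n. finite (L n)" "\<And>n. F \<subseteq> L n"
    by (rule exhaustion[OF V(1) F]) (rule that)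
  have LV: "L n \<subseteq> V" for n using L by auto
  define A where "A n = {\<omega> \<in> space ?P. \<not> cluster V \<omega> x \<subseteq> L n}" for n
  have A_sets: "A n \<in> sets ?P" for n
  proof -
    note measurable_reachable[OF V, measurable]
    have "A n = {\<omega> \<in> space ?P. \<exists>y\<in>V. y \<notin> L n \<and> (x, y) \<in> (open_step V \<omega>)\<^sup>*}"
      using cluster_subset[OF V(2)] unfolding A_def cluster_def by blast
    also have "\<dots> \<in> sets ?P"
      using V(1) by measurable
    finally show ?thesis .
  qed
  have infinite: "{\<omega> \<in> space ?P. cluster_size V \<omega> x = \<infinity>} = (\<Inter>n. A n)"
  proof -
    have "infinite (cluster V \<omega> x) \<longleftrightarrow> (\<forall>n. \<not> cluster V \<omega> x \<subseteq> L n)" for \<omega>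
    proof
      assume "infinite (cluster V \<omega> x)"
      then show "\<forall>n. \<not> cluster V \<omega> x \<subseteq> L n" using L(3) finite_subset by blast
    next
      assume escape: "\<forall>n. \<not> cluster V \<omega> x \<subseteq> L n"
      show "infinite (cluster V \<omega> x)"
      proof
        assume "finite (cluster V \<omega> x)"
        have "\<forall>y\<in>cluster V \<omega> x. \<exists>k. y \<in> L k"
          using cluster_subset[OF V(2)] L(2) by blast
        then obtain k where k: "\<And>y. y \<in> cluster V \<omega> x \<Longrightarrow> y \<in> L (k y)"
          by metis
        have "y \<in> L (Max (k ` cluster V \<omega> x))" if "y \<in> cluster V \<omega> x" for y
          using k[OF that] that \<open>finite (cluster V \<omega> x)\<close>
            incseqD[OF L(1), of "k y" "Max (k ` cluster V \<omega> x)"] by auto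
        then have "cluster V \<omega> x \<subseteq> L (Max (k ` cluster V \<omega> x))"
          by blast
        then show False using escape by blast
      qed
    qed
    then show ?thesis
      by (auto simp: A_def cluster_size_def emeasure_count_space)
  qed
  have "A n \<subseteq> A m" if "m \<le> n" for m n
    using incseqD[OF L(1) that] by (auto simp: A_def)
  then have "decseq A" by (simp add: decseq_def)
  then have "(\<lambda>n. measure ?P (A n)) \<longlonglongrightarrow> measure ?P (\<Inter>n. A n)"
    using A_sets by (intro finite_Lim_measure_decseq) auto
  moreover have "\<kappa> \<le> measure ?P (A n)" for n
  proof -
    obtain M where M: "finite M" "M \<subseteq> V"
      "\<kappa> \<le> bexp (bonds M) (open_prob J \<beta>) (\<lambda>\<omega>. of_bool (\<not> cl M \<omega> x \<subseteq> L n))"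
      using \<kappa>[OF LV L(3) L(4)] by blast
    have "ennreal \<kappa> \<le> ennreal (bexp (bonds M) (open_prob J \<beta>) (\<lambda>\<omega>. of_bool (\<not> cl M \<omega> x \<subseteq> L n)))"
      by (rule ennreal_leI[OF M(3)])
    also have "\<dots> = (\<integral>\<^sup>+\<omega>. ennreal (of_bool (\<not> cl M {e \<in> bonds M. \<omega> e} x \<subseteq> L n)) \<partial>?P)"
      by (rule nn_integral_perc[OF finite_bonds[OF M(1)] bonds_mono[OF M(2)] \<beta>, symmetric]) simp
    also have "\<dots> \<le> (\<integral>\<^sup>+\<omega>. indicator (A n) \<omega> \<partial>?P)"
    proof (rule nn_integral_mono)
      fix \<omega> assume "\<omega> \<in> space ?P"
      then have "ennreal (of_bool (\<not> cluster M \<omega> x \<subseteq> L n)) \<le> indicator (A n) \<omega>"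
        using cluster_mono[OF M(2), of \<omega> x] by (auto simp: A_def indicator_def)
      then show "ennreal (of_bool (\<not> cl M {e \<in> bonds M. \<omega> e} x \<subseteq> L n)) \<le> indicator (A n) \<omega>"
        by (subst cluster_eq_cl[of M \<omega> x, symmetric])
    qed
    also have "\<dots> = ennreal (measure ?P (A n))"
      using A_sets by (simp add: emeasure_eq_measure)
    finally show ?thesis by (simp add: ennreal_le_iff)
  qed
  ultimately show ?thesis
    unfolding infinite by (intro LIMSEQ_le_const) auto
qed

text \<open>The instance of the Harris inequality that makes the critical values independent of the
  starting vertex: the escape of \<open>x\<close> only becomes more likely if the bond from \<open>y\<close> to \<open>x\<close>
  is opened, and \<open>y\<close> escapes together with \<open>x\<close> through this bond.\<close>
lemma escape_transfer:
  assumes M: "M \<subseteq> V" "finite M" "x \<in> M" "y \<in> M" "y \<noteq> x" and \<beta>: "0 \<le> \<beta>"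
  shows "open_prob J \<beta> (Oriented y x) * bexp (bonds M) (open_prob J \<beta>) (\<lambda>\<omega>. of_bool (\<not> cl M \<omega> x \<subseteq> L))
    \<le> bexp (bonds M) (open_prob J \<beta>) (\<lambda>\<omega>. of_bool (\<not> cl M \<omega> y \<subseteq> L))"
proof -
  let ?p = "open_prob J \<beta>"
  define e where "e = Oriented y x"
  define B where "B = bonds M - {e}"
  let ?F = "\<lambda>x \<omega>. of_bool (\<not> cl M \<omega> x \<subseteq> L) :: real"
  have e: "e \<in> bonds M" using M by (auto simp: e_def bonds_def)
  then have B: "bonds M = insert e B" "e \<notin> B" "finite B"
    using finite_bonds[OF M(2)] by (auto simp: B_def)
  have pb: "0 \<le> ?p f \<and> ?p f \<le> 1" if "f \<in> bonds M" for f
    using prob_bounds[OF M(1) \<beta> that] .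
  have pB: "0 \<le> ?p f \<and> ?p f \<le> 1" if "f \<in> B" for f
    using pb that B by blast
  have open_e: "?F x (insert e \<omega>) \<le> ?F y (insert e \<omega>)" for \<omega>
  proof -
    have "(y, x) \<in> open_step M (\<lambda>f. f \<in> insert e \<omega>)"
      unfolding open_step_iff using M by (auto simp: e_def links_def)
    then have "x \<in> cl M (insert e \<omega>) y" by (rule cl_step[OF cl_refl])
    then show ?thesis using cl_trans[of x M "insert e \<omega>" y] by auto
  qed
  have "bexp (insert e B) ?p (?F x) \<le> bexp (insert e B) ?p (\<lambda>\<omega>. ?F x (insert e \<omega>))"
    using pb cl_mono[of M M _ "insert e _" x] unfolding B(1)
    by (intro bexp_mono) (auto, blast)
  also have "\<dots> = bexp B ?p (\<lambda>\<omega>. ?F x (insert e \<omega>))"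
    using B by (simp add: bexp_insert algebra_simps)
  also have "\<dots> \<le> bexp B ?p (\<lambda>\<omega>. ?F y (insert e \<omega>))"
    by (rule bexp_mono[OF pB open_e])
  finally have "?p e * bexp (insert e B) ?p (?F x) \<le> ?p e * bexp B ?p (\<lambda>\<omega>. ?F y (insert e \<omega>))"
    using pb[OF e] by (intro mult_left_mono) auto
  also have "\<dots> \<le> bexp (insert e B) ?p (?F y)"
    unfolding bexp_insert[OF B(3,2)]
  proof -
    have "0 \<le> bexp B ?p (?F y)" by (rule bexp_nonneg[OF pB]) auto
    then show "?p e * bexp B ?p (\<lambda>\<omega>. ?F y (insert e \<omega>))
        \<le> ?p e * bexp B ?p (\<lambda>\<omega>. ?F y (insert e \<omega>)) + (1 - ?p e) * bexp B ?p (?F y)"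
      using pb[OF e] by simp
  qed
  finally show ?thesis unfolding B(1) e_def .
qed

text \<open>The flux is at least \<open>1 / \<beta>0\<close>. Half of it is given up for the truncation of the range,
  and the other half is the constant \<open>c\<close> of the differential inequality.\<close>
lemma infinite_cluster_if_flux_large:
  assumes V: "countable V" "x \<in> V" "y \<in> V" and \<beta>: "0 < \<beta>0" "\<beta>0 < \<beta>1"
    and flux: "\<And>S. finite S \<Longrightarrow> S \<subseteq> V \<Longrightarrow> x \<in> S \<Longrightarrow> 1 \<le> \<beta>0 * flux V J \<beta>0 S x"
  shows "0 < \<P>(\<omega> in perc V J \<beta>1. cluster_size V \<omega> y = \<infinity>)"
proof -
  define c where "c = 1 / (2 * \<beta>0)"
  define \<kappa> where "\<kappa> = 1 - exp (- c * (\<beta>1 - \<beta>0))"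
  define q where "q = (if y = x then 1 else open_prob J \<beta>1 (Oriented y x))"
  have c: "0 < c" using \<beta> by (simp add: c_def)
  have \<kappa>: "0 < \<kappa>" using \<beta> c by (simp add: \<kappa>_def)
  have q: "0 < q"
  proof (cases "y = x")
    case False
    then have "0 < J (Oriented y x)" using V by (intro pos) (auto simp: bonds_def)
    then show ?thesis using False \<beta> by (simp add: q_def open_prob_def)
  qed (simp add: q_def)
  have "q * \<kappa> \<le> \<P>(\<omega> in perc V J \<beta>1. cluster_size V \<omega> y = \<infinity>)"
  proof (rule prob_infinite_cluster_ge[OF V(1,3), of "{x, y}"])
    fix L assume L: "L \<subseteq> V" "finite L" "{x, y} \<subseteq> L"
    obtain M where M: "L \<subseteq> M" "M \<subseteq> V" "finite M"
      and trunc: "\<And>S. S \<subseteq> L \<Longrightarrow> flux V J \<beta>0 S x - c \<le> flux M J \<beta>0 S x"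
      using flux_truncate[OF L(1,2) less_imp_le[OF \<beta>(1)] c] by blast
    have "c \<le> flux M J \<beta>0 S x" if S: "S \<subseteq> L" "x \<in> S" for S
    proof -
      have "1 \<le> \<beta>0 * flux V J \<beta>0 S x"
        using S L finite_subset by (intro flux) auto
      then have "2 * c \<le> flux V J \<beta>0 S x"
        using \<beta> by (simp add: c_def field_simps)
      then show ?thesis using trunc[OF S(1)] by simp
    qed
    then have "\<kappa> \<le> bexp (bonds M) (open_prob J \<beta>1) (\<lambda>\<omega>. of_bool (\<not> cl M \<omega> x \<subseteq> L))"
      unfolding \<kappa>_def using L M \<beta> by (intro escape_prob_ge) auto
    then have "q * \<kappa> \<le> q * bexp (bonds M) (open_prob J \<beta>1) (\<lambda>\<omega>. of_bool (\<not> cl M \<omega> x \<subseteq> L))"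
      using q by simp
    also have "\<dots> \<le> bexp (bonds M) (open_prob J \<beta>1) (\<lambda>\<omega>. of_bool (\<not> cl M \<omega> y \<subseteq> L))"
      using escape_transfer[OF M(2,3), of x y \<beta>1 L] L M \<beta> by (auto simp: q_def)
    finally show "\<exists>M. finite M \<and> M \<subseteq> V \<and>
        q * \<kappa> \<le> bexp (bonds M) (open_prob J \<beta>1) (\<lambda>\<omega>. of_bool (\<not> cl M \<omega> y \<subseteq> L))"
      using M by blast
  qed (use V \<beta> in auto)
  then show ?thesis using mult_pos_pos[OF q \<kappa>] by linarith
qed

lemma sharpness:
  assumes V: "countable V" "x \<in> V" and E: "quasi_transitive V E" "aut_invariant V E J"
    and \<beta>: "0 < \<beta>0" "\<beta>0 < \<beta>1"
    and zero: "\<P>(\<omega> in perc V J \<beta>1. cluster_size V \<omega> x = \<infinity>) = 0"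
  shows "(\<integral>\<^sup>+\<omega>. cluster_size V \<omega> x \<partial>perc V J \<beta>0) < \<infinity>"
proof -
  have small: "\<exists>S. finite S \<and> S \<subseteq> V \<and> z \<in> S \<and> \<beta>0 * flux V J \<beta>0 S z < 1" if z: "z \<in> V" for z
  proof (rule ccontr)
    assume "\<not> ?thesis"
    then have "0 < \<P>(\<omega> in perc V J \<beta>1. cluster_size V \<omega> x = \<infinity>)"
      by (intro infinite_cluster_if_flux_large[OF V(1) z V(2) \<beta>]) (meson not_le)
    then show False using zero by simp
  qed
  obtain N d where d: "0 < d" and flux: "\<And>x. x \<in> V \<Longrightarrow>
      \<exists>S. finite S \<and> S \<subseteq> V \<and> x \<in> S \<and> card S \<le> N \<and> \<beta>0 * flux V J \<beta>0 S x \<le> 1 - d"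
    by (rule uniform_flux_bound[OF E small], assumption) (rule that)
  have \<beta>0: "0 \<le> \<beta>0" using \<beta> by simp
  have "(\<integral>\<^sup>+\<omega>. cluster_size V \<omega> x \<partial>perc V J \<beta>0) \<le> ennreal (real N / d)"
    by (rule expected_cluster_size_le[OF V \<beta>0])
      (rule expected_volume_bound[OF \<beta>0 d _ _ flux])
  then show ?thesis
    by (rule order_le_less_trans) simp
qed

end

theorem mainTheorem4:
  fixes V :: "'v set" and E :: "'v set set" and J :: "'v bond \<Rightarrow> real"
  assumes "simple_graph V E"
    and "infinite V" and "countable V"
    and "connected_graph V E"
    and "locally_finite_graph V E"
    and "quasi_transitive V E"
    and "\<forall>e\<in>bonds V. 0 < J e"
    and "aut_invariant V E J"
    and "J0 V J < \<infinity>"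
  shows "\<forall>x\<in>V. beta_H V J x = beta_T V J x"
proof
  fix x assume x: "x \<in> V"
  interpret percolation V J
  proof
    show "0 < J e" if "e \<in> bonds V" for e using assms(7) that by blast
    fix y assume y: "y \<in> V"
    have nn: "0 \<le> pair_rate J y z" if "z \<in> V" for z
      using assms(7) links_subset_bonds[OF y that]
      by (auto simp: pair_rate_def links_def intro!: less_imp_le add_pos_pos)
    have "(\<Sum>\<^sub>\<infinity>z\<in>V - {y}. ennreal (pair_rate J y z))
        = (\<Sum>\<^sub>\<infinity>z\<in>V - {y}. ennreal (J (Unoriented {y, z}) + J (Oriented y z)))"
      by (rule infsum_cong) (auto simp: pair_rate_def)
    also have "\<dots> \<le> J0 V J"
      unfolding J0_def using y by (rule SUP_upper)
    finally have fin: "(\<Sum>\<^sub>\<infinity>z\<in>V - {y}. ennreal (pair_rate J y z)) < \<infinity>"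
      using assms(9) by (rule order_le_less_trans)
    have "pair_rate J y summable_on (V - {y})"
    proof (rule nonneg_bdd_above_summable_on)
      have "sum (pair_rate J y) F \<le> enn2real (\<Sum>\<^sub>\<infinity>z\<in>V - {y}. ennreal (pair_rate J y z))"
        if F: "F \<subseteq> V - {y}" "finite F" for F
      proof -
        have "ennreal (sum (pair_rate J y) F) = (\<Sum>z\<in>F. ennreal (pair_rate J y z))"
          using F nn by (intro sum_ennreal[symmetric]) auto
        also have "\<dots> \<le> (\<Sum>\<^sub>\<infinity>z\<in>V - {y}. ennreal (pair_rate J y z))"
          using F by (subst nonneg_infsum_complete) (auto intro!: SUP_upper)
        finally have "enn2real (ennreal (sum (pair_rate J y) F))
            \<le> enn2real (\<Sum>\<^sub>\<infinity>z\<in>V - {y}. ennreal (pair_rate J y z))"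
          using fin by (intro enn2real_mono) auto
        moreover have "0 \<le> sum (pair_rate J y) F"
          using F nn by (intro sum_nonneg) auto
        ultimately show ?thesis by simp
      qed
      then show "bdd_above (sum (pair_rate J y) ` {F. F \<subseteq> V - {y} \<and> finite F})"
        by (intro bdd_aboveI2) auto
    qed (use nn in auto)
    moreover have "pair_rate J y summable_on {y}" by simp
    ultimately have "pair_rate J y summable_on (V - {y}) \<union> {y}"
      by (rule summable_on_Un_disjoint) simp
    then show "pair_rate J y summable_on V" using y by (simp add: insert_absorb)
  qed
  show "beta_H V J x = beta_T V J x"
  proof (rule antisym)
    show "beta_T V J x \<le> beta_H V J x"
      unfolding beta_T_def beta_H_def
    proof (rule SUP_subset_mono[OF _ order_refl], safe)
      fix \<beta> :: real assume \<beta>: "0 < \<beta>" "(\<integral>\<^sup>+\<omega>. cluster_size V \<omega> x \<partial>perc V J \<beta>) < \<infinity>"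
      have "AE \<omega> in perc V J \<beta>. cluster_size V \<omega> x \<noteq> \<infinity>"
        using \<beta>(2) by (intro nn_integral_PInf_AE measurable_cluster_size assms(3) x) auto
      then show "\<P>(\<omega> in perc V J \<beta>. cluster_size V \<omega> x = \<infinity>) = 0"
        using prob_space.prob_eq_0[OF prob_space_perc]
          measurable_cluster_size[OF assms(3) x] 
        by simp
    qed
    show "beta_H V J x \<le> beta_T V J x"
      unfolding beta_H_def
    proof (rule SUP_least, safe)
      fix \<beta> :: real
      assume \<beta>: "0 < \<beta>" "\<P>(\<omega> in perc V J \<beta>. cluster_size V \<omega> x = \<infinity>) = 0"
      have below: "ennreal b \<le> beta_T V J x" if b: "0 < b" "b < \<beta>" for b
        unfolding beta_T_def
        using sharpness[OF assms(3) x assms(6,8) b \<beta>(2)] b by (intro SUP_upper) simp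
      show "ennreal \<beta> \<le> beta_T V J x"
      proof (rule dense_le)
        fix a assume a: "a < ennreal \<beta>"
        then obtain r where r: "0 \<le> r" "a = ennreal r"
          by (cases a) auto
        have "a \<le> ennreal ((r + \<beta>) / 2)"
          using r a \<beta>(1) by (auto simp: ennreal_less_iff intro!: ennreal_leI)
        also have "\<dots> \<le> beta_T V J x"
          using r a \<beta>(1) by (intro below) (auto simp: ennreal_less_iff)
        finally show "a \<le> beta_T V J x" .
      qed
    qed
  qed
qed

end
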